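(* Assume hypothesis (H). Then $$\sum_{N>0}\dim_{\mathbb Q}\ker C_{N,3}\, x^N\;\ge\; 2\,\mathbb O(x)\,\mathbb S(x),$$ where $\ge$ between power series means coefficientwise inequality.
   Context: For integers $N,r\ge1$ let $S_{N,r}=\{(n_1,\dots,n_r)\in\mathbb Z^r:\ n_1+\dots+n_r=N,\ \text{each } n_i\ge3 \text{ odd}\}$; when used as an index set it is ordered lexicographically decreasingly. For $m=(m_1,\dots,m_r)$ and $n=(n_1,\dots,n_r)$ let $\delta\binom{m}{n}=1$ if $m_i=n_i$ for all $i$, and $0$ otherwise. $\mathbf V_{N,r}$ is the $\mathbb Q$-span of the monomials $x_1^{n_1-1}\cdots x_r^{n_r-1}$ with $(n_1,\dots,n_r)\in S_{N,r}$. $\mathsf{Vect}_{N,r}=\mathbb Q^{S_{N,r}}$ (row vectors), and $\pi:\mathbf V_{N,r}\to\mathsf{Vect}_{N,r}$ is the isomorphism sending $\sum a_{n_1,\dots,n_r}x_1^{n_1-1}\cdots x_r^{n_r-1}$ to $(a_{n_1,\dots,n_r})_{(n_1,\dots,n_r)\in S_{N,r}}$. For $r\ge2$, $\mathbf W_{N,r}=\{P\in\mathbf V_{N,r}: P(x_1,\dots,x_r)=P(x_2-x_1,x_2,x_3,\dots,x_r)-P(x_2-x_1,x_1,x_3,\dots,x_r)\}$. Ihara action: for $f\in\mathbb Q[t]$ and a polynomial $g$ in $r-1$ variables, $(f\mathbin{\underline\circ}g)(x_1,\dots,x_r)=f(x_1)g(x_2,\dots,x_r)+\sum_{i=1}^{r-1}\big(f(x_{i+1}-x_i)g(x_1,\dots,\widehat{x_{i+1}},\dots,x_r)-(-1)^{\deg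 f}f(x_i-x_{i+1})g(x_1,\dots,\widehat{x_i},\dots,x_r)\big)$ (hats denote omitted variables). For positive integers $m_i,n_i$, $e\binom{m_1,\dots,m_r}{n_1,\dots,n_r}$ is the coefficient of $x_1^{n_1-1}\cdots x_r^{n_r-1}$ in $t^{m_1-1}\mathbin{\underline\circ}\,(y_1^{m_2-1}\cdots y_{r-1}^{m_r-1})$. $E_{N,r}$ is the $S_{N,r}\times S_{N,r}$ matrix with $(m,n)$-entry $e\binom{m}{n}$. For $2\le j\le r$, $E^{(j)}_{N,r}$ is the $S_{N,r}\times S_{N,r}$ matrix with $(m,n)$-entry $\delta\binom{m_1,\dots,m_{r-j}}{n_1,\dots,n_{r-j}}\,e\binom{m_{r-j+1},\dots,m_r}{n_{r-j+1},\dots,n_r}$ (so $E^{(r)}_{N,r}=E_{N,r}$). $C_{N,r}=E^{(2)}_{N,r}E^{(3)}_{N,r}\cdots E^{(r-1)}_{N,r}E_{N,r}$ (so $C_{N,2}=E_{N,2}$), and $F_{N,r}=E_{N,r}-\mathrm{id}$. For a matrix $A$, $\ker A$ denotes its right kernel (column vectors $v$ with $Av=0$). $\mathbb O(x)=\frac{x^3}{1-x^2}$, $\mathbb S(x)=\frac{x^{12}}{(1-x^4)(1-x^6)}$. It is known (Tasaka) that for $r\ge2$ and $P\in\mathbf W_{N,r}$, $\pi(P)F_{N,r}$ lies in the left kernel $\{v: vE_{N,r}=0\}$. Hypothesis (H): for all $N$ and all $r\ge2$ the linear map $\mathbf W_{N,r}\to\{v\in\mathsf{Vect}_{N,r}: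 vE_{N,r}=0\}$, $P\mapsto\pi(P)F_{N,r}$, is injective. *)

theory Defs
  imports "Jordan_Normal_Form.Matrix_Kernel" "HOL-Library.Poly_Mapping"
    "HOL-Library.List_Lexorder" "HOL-Computational_Algebra.Formal_Power_Series"
begin

text \<open>Multivariate polynomials over Q in variables x_1, x_2, ... are modelled as
  finitely supported maps from exponent vectors (nat =>0 nat) to rat, with the
  convolution product of Poly_Mapping.  The variable x_(i+1) is qvar i (0-indexed).\<close>

type_synonym qpoly = "(nat \<Rightarrow>\<^sub>0 nat) \<Rightarrow>\<^sub>0 rat"

definition qvar :: "nat \<Rightarrow> qpoly" where
  "qvar i = Poly_Mapping.single (Poly_Mapping.single i 1) 1"

definition mono_at :: "qpoly list \<Rightarrow> nat list \<Rightarrow> qpoly" where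
  "mono_at ps es = prod_list (map (\<lambda>(p, e). p ^ e) (zip ps es))"

definition expvec :: "nat list \<Rightarrow> (nat \<Rightarrow>\<^sub>0 nat)" where
  "expvec es = sum_list (map (\<lambda>(j, e). Poly_Mapping.single j e) (zip [0..<length es] es))"

definition Sset :: "nat \<Rightarrow> nat \<Rightarrow> nat list set" where
  "Sset N r = {ns. length ns = r \<and> (\<forall>n\<in>set ns. odd n \<and> 3 \<le> n) \<and> sum_list ns = N}"

definition Slist :: "nat \<Rightarrow> nat \<Rightarrow> nat list list" where
  "Slist N r = rev (sorted_list_of_set (Sset N r))"

definition sdim :: "nat \<Rightarrow> nat \<Rightarrow> nat" where
  "sdim N r = length (Slist N r)"

text \<open>Ihara action t^a o (y_1^(bs!0) ... y_(r-1)^(bs!(r-2))), r = length bs + 1\<close>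
definition ihara :: "nat \<Rightarrow> nat list \<Rightarrow> qpoly" where
  "ihara a bs = (let r = Suc (length bs) in
     qvar 0 ^ a * mono_at (map qvar [1..<r]) bs
     + (\<Sum>i\<in>{1..<r}.
          (qvar i - qvar (i - 1)) ^ a * mono_at (map qvar (filter (\<lambda>j. j \<noteq> i) [0..<r])) bs
        - (-1) ^ a * (qvar (i - 1) - qvar i) ^ a
            * mono_at (map qvar (filter (\<lambda>j. j \<noteq> i - 1) [0..<r])) bs))"

definition ecoef :: "nat list \<Rightarrow> nat list \<Rightarrow> rat" where
  "ecoef m n = Poly_Mapping.lookup (ihara (hd m - 1) (map (\<lambda>k. k - 1) (tl m))) (expvec (map (\<lambda>k. k - 1) n))"

definition Ej :: "nat \<Rightarrow> nat \<Rightarrow> nat \<Rightarrow> rat mat" where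
  "Ej N r j = mat (sdim N r) (sdim N r) (\<lambda>(p, q).
     let m = Slist N r ! p; n = Slist N r ! q in
     (if take (r - j) m = take (r - j) n then 1 else 0) * ecoef (drop (r - j) m) (drop (r - j) n))"

definition Emat :: "nat \<Rightarrow> nat \<Rightarrow> rat mat" where
  "Emat N r = mat (sdim N r) (sdim N r) (\<lambda>(p, q). ecoef (Slist N r ! p) (Slist N r ! q))"

definition Cmat :: "nat \<Rightarrow> nat \<Rightarrow> rat mat" where
  "Cmat N r = foldr (\<lambda>j M. Ej N r j * M) [2..<r] (Emat N r)"

definition Fmat :: "nat \<Rightarrow> nat \<Rightarrow> rat mat" where
  "Fmat N r = Emat N r - 1\<^sub>m (sdim N r)"

definition poly_of :: "nat \<Rightarrow> nat \<Rightarrow> rat vec \<Rightarrow> qpoly list \<Rightarrow> qpoly" where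
  "poly_of N r v ps = (\<Sum>q<sdim N r. Poly_Mapping.single 0 (v $ q)
       * mono_at ps (map (\<lambda>k. k - 1) (Slist N r ! q)))"

definition Wvec :: "nat \<Rightarrow> nat \<Rightarrow> rat vec set" where
  "Wvec N r = {v \<in> carrier_vec (sdim N r).
     poly_of N r v (map qvar [0..<r])
       = poly_of N r v ((qvar 1 - qvar 0) # qvar 1 # map qvar [2..<r])
       - poly_of N r v ((qvar 1 - qvar 0) # qvar 0 # map qvar [2..<r])}"

text \<open>Hypothesis (H): P |-> pi(P) F_{N,r} is injective on W_{N,r}; the row vector
  pi(P) F is represented as the column vector F^T pi(P)^T.\<close>
definition hypH :: bool where
  "hypH = (\<forall>N r. 2 \<le> r \<longrightarrow> inj_on (\<lambda>v. transpose_mat (Fmat N r) *\<^sub>v v) (Wvec N r))"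

definition Ofps :: "rat fps" where
  "Ofps = fps_X ^ 3 * inverse (1 - fps_X ^ 2)"

definition Sfps :: "rat fps" where
  "Sfps = fps_X ^ 12 * inverse ((1 - fps_X ^ 4) * (1 - fps_X ^ 6))"

end

theory Submission
  imports Defs
begin

text \<open>
  Write \<open>P\<close> for the polynomial of a row vector and let \<open>W\<close> consist of the \<open>P\<close> that are even period
  polynomials in \<open>x\<^sub>1, x\<^sub>2\<close>. On \<open>W\<close>, which is antisymmetric in \<open>x\<^sub>1, x\<^sub>2\<close>, three of the five terms of
  \<open>P E\<close> cancel and the other two are those of \<open>-P E2\<close>, so that \<open>P F = -P E2\<close>, where \<open>E2\<close> is the
  factor \<open>Ej N 3 2\<close>. Computing the even part of \<open>P E2\<close> explicitly and using the three-term relation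
  again gives \<open>P E2 E = 0\<close>. The polynomials that are period polynomials in \<open>x\<^sub>2, x\<^sub>3\<close> form a second
  space \<open>W'\<close>, which is killed by \<open>E2\<close> itself. Hypothesis (H) says that \<open>E2\<close> is injective on \<open>W\<close>,
  so \<open>W\<close> and \<open>W'\<close> are independent and both lie in the left kernel of \<open>C = E2 E\<close>.

  The dimension of either space is bounded below by counting linear equations: an antisymmetric
  even \<open>p\<close> of degree \<open>k\<close> is a period polynomial as soon as \<open>k div 6\<close> coefficients of the form
  \<open>p(x,y) + p(y,y-x) + p(y-x,x)\<close>, which is alternating under \<open>S\<^sub>3\<close>, vanish.
\<close>

section \<open>Linear algebra and dimension counts\<close>

text \<open>Gaussian elimination by induction on the equations: an unknown \<open>i0\<close> with
  nonzero coefficient in equation \<open>j0\<close> is eliminated from the others and recovered as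
  \<open>t\<close>. The dimension estimate at the end comes from applying this to one large
  system.\<close>

lemma homogeneous_system_nontrivial_solution:
  fixes c :: "'j \<Rightarrow> 'i \<Rightarrow> 'a :: field"
  assumes "finite J" "finite I" "card J < card I"
  shows "\<exists>x. (\<exists>i\<in>I. x i \<noteq> 0) \<and> (\<forall>j\<in>J. (\<Sum>i\<in>I. c j i * x i) = 0)"
  using assms
proof (induction J arbitrary: I c rule: finite_induct)
  case empty
  then obtain i where "i \<in> I" by fastforce
  then show ?case by (intro exI[of _ "\<lambda>_. 1"]) auto
next
  case (insert j0 J)
  show ?case
  proof (cases "\<forall>i\<in>I. c j0 i = 0")
    case True
    obtain x where "\<exists>i\<in>I. x i \<noteq> 0" "\<forall>j\<in>J. (\<Sum>i\<in>I. c j i * x i) = 0"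
      using insert.IH[of I c] insert.prems insert.hyps by auto
    then show ?thesis using True by (intro exI[of _ x]) auto
  next
    case False
    then obtain i0 where i0: "i0 \<in> I" "c j0 i0 \<noteq> 0" by auto
    define c' where "c' j i = c j i - c j i0 * c j0 i / c j0 i0" for j i
    have "card J < card (I - {i0})" using insert i0 by auto
    then obtain x where x: "\<exists>i\<in>I - {i0}. x i \<noteq> 0"
        "\<forall>j\<in>J. (\<Sum>i\<in>I - {i0}. c' j i * x i) = 0"
      using insert.IH[of "I - {i0}" c'] insert.prems by auto
    define t where "t = - (\<Sum>i\<in>I - {i0}. c j0 i * x i) / c j0 i0"
    define y where "y = x(i0 := t)"
    have expand: "(\<Sum>i\<in>I. c j i * y i) = c j i0 * t + (\<Sum>i\<in>I - {i0}. c j i * x i)" for j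
    proof -
      have "(\<Sum>i\<in>I. c j i * y i) = c j i0 * y i0 + (\<Sum>i\<in>I - {i0}. c j i * y i)"
        using insert.prems i0 by (simp add: sum.remove)
      also have "(\<Sum>i\<in>I - {i0}. c j i * y i) = (\<Sum>i\<in>I - {i0}. c j i * x i)"
        by (rule sum.cong) (auto simp: y_def)
      finally show ?thesis by (simp add: y_def)
    qed
    have "(\<Sum>i\<in>I. c j i * y i) = 0" if "j \<in> J" for j
    proof -
      have "0 = (\<Sum>i\<in>I - {i0}. c j i * x i - c j i0 / c j0 i0 * (c j0 i * x i))"
        using x(2) that by (simp add: c'_def left_diff_distrib mult.assoc)
      also have "\<dots> = (\<Sum>i\<in>I - {i0}. c j i * x i) + c j i0 * t"
        by (simp add: sum_subtractf t_def sum_distrib_left sum_divide_distrib)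
      finally show ?thesis using expand[of j] by (simp add: add.commute)
    qed
    moreover have "(\<Sum>i\<in>I. c j0 i * y i) = 0"
      using i0 by (simp add: expand t_def)
    moreover have "\<exists>i\<in>I. y i \<noteq> 0" using x(1) by (auto simp: y_def)
    ultimately show ?thesis by (intro exI[of _ y]) auto
  qed
qed

text \<open>Up to an invertible change of coordinates, a left kernel vector is supported on the
  non-pivot rows of the echelon form, and for a square matrix there are \<open>kernel_dim A\<close> of those.\<close>
lemma left_kernel_coordinates:
  fixes A :: "'a :: field mat"
  assumes A: "A \<in> carrier_mat n n"
  obtains J :: "nat set" and D :: "nat \<Rightarrow> nat \<Rightarrow> 'a"
  where "finite J" "card J = kernel_dim A"
    "\<forall>v\<in>carrier_vec n. transpose_mat A *\<^sub>v v = 0\<^sub>v n \<longrightarrow>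
      (\<forall>j\<in>J. (\<Sum>i<n. D j i * v $ i) = 0) \<longrightarrow> v = 0\<^sub>v n"
proof -
  define B where "B = gauss_jordan_single A"
  note gj = gauss_jordan_single[OF A B_def[symmetric]]
  from gj(4) obtain P Q where P: "P \<in> carrier_mat n n" and Q: "Q \<in> carrier_mat n n"
    and BPA: "B = P * A" and QP: "Q * P = 1\<^sub>m n" by auto
  have B: "B \<in> carrier_mat n n" by (rule gj(2))
  from gj(3) obtain f where f: "pivot_fun B f n"
    using B by (auto simp: row_echelon_form_def)
  note piv = pivot_funD[OF carrier_matD(1)[OF B] f]
  define J where "J = {i. i < n \<and> f i = n}"
  have "{i. i < n \<and> row B i \<noteq> 0\<^sub>v n} = {..<n} - J"
    using pivot_fun_zero_row_iff[OF f B] by (auto simp: J_def)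
  moreover have "J \<subseteq> {..<n}" by (auto simp: J_def)
  ultimately have "card {i. i < n \<and> row B i \<noteq> 0\<^sub>v n} = n - card J"
    by (simp add: card_Diff_subset finite_subset)
  then have cardJ: "card J = kernel_dim A"
    using kernel_dim_code[of A] pivot_positions(4)[OF B f] A \<open>J \<subseteq> {..<n}\<close>
      card_mono[of "{..<n}" J]
    by (simp add: B_def)
  have AQB: "A = Q * B" using A P Q QP by (simp add: BPA assoc_mult_mat[of Q n n P n A n, symmetric])
  have "v = 0\<^sub>v n" if v: "v \<in> carrier_vec n" and ker: "transpose_mat A *\<^sub>v v = 0\<^sub>v n"
    and D: "\<And>j. j \<in> J \<Longrightarrow> (\<Sum>i<n. Q $$ (i, j) * v $ i) = 0" for v
  proof -
    \<comment> \<open>Since \<open>A = Q * B\<close>, \<open>u\<close> lies in the left kernel of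
      \<open>B\<close>. A pivot column of \<open>B\<close> has a single nonzero entry, which forces
      the pivot coordinates of \<open>u\<close> to vanish; \<open>D\<close> asks for the vanishing
      of the others.\<close>
    define u where "u = transpose_mat Q *\<^sub>v v"
    have u: "u \<in> carrier_vec n" using Q v by (simp add: u_def)
    have u_index: "u $ j = (\<Sum>i<n. Q $$ (i, j) * v $ i)" if "j < n" for j
      using that Q v by (simp add: u_def scalar_prod_def lessThan_atLeast0)
    have uB: "transpose_mat B *\<^sub>v u = 0\<^sub>v n"
      using ker B Q v by (simp add: AQB transpose_mult u_def)
    have "u $ j = 0" if j: "j < n" for j
    proof (cases "f j = n")
      case True
      then show ?thesis using D u_index j by (simp add: J_def)
    next
      case False
      then have fj: "f j < n" using piv(1)[OF j] by simp
      have "0 = (transpose_mat B *\<^sub>v u) $ f j" using uB fj by simp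
      also have "\<dots> = (\<Sum>i<n. B $$ (i, f j) * u $ i)"
        using fj B u by (simp add: scalar_prod_def lessThan_atLeast0)
      also have "\<dots> = (\<Sum>i\<in>{j}. B $$ (i, f j) * u $ i)"
        using piv(5)[OF j fj] j by (intro sum.mono_neutral_right) auto
      also have "\<dots> = u $ j" using piv(4)[OF j fj] by simp
      finally show ?thesis by simp
    qed
    then have u0: "u = 0\<^sub>v n" using u by auto
    have "transpose_mat P *\<^sub>v u = transpose_mat (Q * P) *\<^sub>v v"
      using P Q v by (simp add: transpose_mult u_def)
    moreover have "transpose_mat P *\<^sub>v 0\<^sub>v n = 0\<^sub>v n"
      using P by (intro eq_vecI) auto
    ultimately show ?thesis using QP v u0 by (simp add: transpose_one)
  qed
  moreover have "finite J" by (simp add: J_def)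
  ultimately show ?thesis
    using that[of J "\<lambda>j i. Q $$ (i, j)"] cardJ by blast
qed

section \<open>Coefficients of the two generating series\<close>

lemma fps_nth_Ofps: "fps_nth Ofps c = (if odd c \<and> 3 \<le> c then 1 else 0)"
proof -
  define g :: "rat fps" where "g = Abs_fps (\<lambda>n. if even n then 1 else 0)"
  have "g * (1 - fps_X ^ 2) = 1"
    by (rule fps_ext) (auto simp: g_def algebra_simps fps_X_power_mult_nth)
  then have "inverse (1 - fps_X ^ 2) = g"
    by (metis fps_inverse_unique mult.commute)
  then show ?thesis
    by (auto simp: Ofps_def g_def fps_X_power_mult_nth)
qed

text \<open>The dimension of the space of cusp forms of weight \<open>k\<close> for the full modular
  group. For \<open>k = 2\<close> truncated subtraction gives the correct value 0.\<close>

definition cusp_dim :: "nat \<Rightarrow> nat" where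
  "cusp_dim k = (if odd k then 0 else if k mod 12 = 2 then k div 12 - 1 else k div 12)"

lemma cusp_dim_block:
  "r < 12 \<Longrightarrow> cusp_dim (12 * q + r) = (if odd r then 0 else if r = 2 then q - 1 else q)"
  by (auto simp: cusp_dim_def)

lemma less_12_cases:
  assumes "(r :: nat) < 12"
  obtains "r = 0" | "r = 1" | "r = 2" | "r = 3" | "r = 4" | "r = 5" | "r = 6" | "r = 7"
    | "r = 8" | "r = 9" | "r = 10" | "r = 11"
proof -
  have "r = 0 \<or> r = 1 \<or> r = 2 \<or> r = 3 \<or> r = 4 \<or> r = 5 \<or> r = 6 \<or> r = 7
      \<or> r = 8 \<or> r = 9 \<or> r = 10 \<or> r = 11"
    using assms by presburger
  then show ?thesis using that by blast
qed

text \<open>The right side will count the unknowns left after antisymmetry for two indices of sum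
  \<open>k\<close>, and \<open>(k - 2) div 6\<close> the equations still imposed on them, so
  \<open>cusp_dim k\<close> is the excess.\<close>

lemma cusp_dim_eq:
  assumes "even k"
  shows "cusp_dim k + (k - 2) div 6 = (k div 2 - 2) div 2"
proof -
  define q r where "q = k div 12" and "r = k mod 12"
  have k: "k = 12 * q + r" and r: "r < 12" by (auto simp: q_def r_def)
  have "even r" using assms k by simp
  show ?thesis
  proof (cases q)
    case 0
    then show ?thesis using r \<open>even r\<close> unfolding k by (elim less_12_cases) (simp_all add: cusp_dim_def)
  next
    case (Suc p)
    have "k - 2 = 12 * p + (r + 10)" "k div 2 - 2 = (6 * p + 4) + r div 2"
      unfolding k Suc by auto
    moreover have "cusp_dim k = (if r = 2 then p else Suc p)"
      unfolding k cusp_dim_block[OF r] using \<open>even r\<close> Suc by simp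
    moreover have "(12 * p + (r + 10)) div 6 = 2 * p + (r + 10) div 6"
      "(6 * p + 4 + r div 2) div 2 = 3 * p + 2 + r div 2 div 2" by presburger+
    ultimately have "?thesis \<longleftrightarrow> (if r = 2 then p else Suc p) + (2 * p + (r + 10) div 6)
        = 3 * p + 2 + r div 2 div 2" by (simp only:)
    then show ?thesis using r \<open>even r\<close> by (elim less_12_cases) simp_all
  qed
qed

text \<open>Multiplication by \<open>(1 - x^4) (1 - x^6) = 1 - x^4 - x^6 + x^10\<close>, written out
  on coefficients; the product is \<open>x^12\<close>.\<close>

lemma cusp_dim_recurrence:
  "int (cusp_dim n) - (if n < 4 then 0 else int (cusp_dim (n - 4)))
    - (if n < 6 then 0 else int (cusp_dim (n - 6)))
    + (if n < 10 then 0 else int (cusp_dim (n - 10))) = (if n = 12 then 1 else 0)"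
proof -
  define q r where "q = n div 12" and "r = n mod 12"
  have n: "n = 12 * q + r" and r: "r < 12" by (auto simp: q_def r_def)
  \<comment> \<open>In the first two blocks of 12 the subtractions can become negative or meet the
    truncation in \<open>cusp_dim\<close>. From the third block on, \<open>n - j\<close> simply lies
    in the same or the preceding block.\<close>
  consider "q = 0" | "q = 1" | p where "q = p + 2"
    by (metis One_nat_def add_2_eq_Suc' not0_implies_Suc)
  then show ?thesis
  proof cases
    case 1
    then show ?thesis using r unfolding n by (elim less_12_cases) (simp_all add: cusp_dim_def)
  next
    case 2
    then show ?thesis using r unfolding n by (elim less_12_cases) (simp_all add: cusp_dim_def)
  next
    case 3
    have shift: "cusp_dim (n - j) = (if odd (r + 12 - j) then 0
        else if j \<le> r then if r - j = 2 then p + 1 else p + 2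
        else if r + 12 - j = 2 then p else p + 1)" if "j \<le> 12" for j
    proof (cases "j \<le> r")
      case True
      then have "n - j = 12 * (p + 2) + (r - j)" "odd (r + 12 - j) = odd (r - j)"
        unfolding n 3 by auto
      then show ?thesis using True r cusp_dim_block[of "r - j" "p + 2"] by auto
    next
      case False
      then have "n - j = 12 * (p + 1) + (r + 12 - j)" using that unfolding n 3 by auto
      then show ?thesis using False r cusp_dim_block[of "r + 12 - j" "p + 1"] by auto
    qed
    have "\<not> n < 4" "\<not> n < 6" "\<not> n < 10" "n \<noteq> 12" unfolding n 3 by auto
    then show ?thesis using r shift[of 0] shift[of 4] shift[of 6] shift[of 10]
      by (elim less_12_cases) simp_all
  qed
qed

lemma fps_nth_Sfps: "fps_nth Sfps k = of_nat (cusp_dim k)"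
proof -
  define g :: "rat fps" where "g = Abs_fps (\<lambda>n. of_nat (cusp_dim n))"
  have "g * ((1 - fps_X ^ 4) * (1 - fps_X ^ 6)) = fps_X ^ 12"
  proof (rule fps_ext)
    fix n
    have "g * ((1 - fps_X ^ 4) * (1 - fps_X ^ 6))
        = g - fps_X ^ 4 * g - fps_X ^ 6 * g + fps_X ^ 10 * g"
      by (simp add: algebra_simps flip: power_add)
    also have "fps_nth \<dots> n = of_int (int (cusp_dim n)
        - (if n < 4 then 0 else int (cusp_dim (n - 4)))
        - (if n < 6 then 0 else int (cusp_dim (n - 6)))
        + (if n < 10 then 0 else int (cusp_dim (n - 10))))"
      by (simp add: g_def fps_X_power_mult_nth)
    also have "\<dots> = fps_nth (fps_X ^ 12) n"
      unfolding cusp_dim_recurrence by (simp add: fps_X_power_nth)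
    finally show "fps_nth (g * ((1 - fps_X ^ 4) * (1 - fps_X ^ 6))) n = fps_nth (fps_X ^ 12) n" .
  qed
  moreover define d :: "rat fps" where "d = (1 - fps_X ^ 4) * (1 - fps_X ^ 6)"
  moreover have "d * inverse d = 1"
    by (intro inverse_mult_eq_1') (simp add: d_def)
  ultimately have "Sfps = g"
    unfolding Sfps_def by (metis mult.assoc mult.right_neutral)
  show ?thesis unfolding \<open>Sfps = g\<close> g_def by simp
qed

section \<open>Alternating binary forms\<close>

definition binary_form :: "nat \<Rightarrow> (nat \<Rightarrow> rat) \<Rightarrow> rat \<Rightarrow> rat \<Rightarrow> rat" where
  "binary_form k \<alpha> x y = (\<Sum>i\<le>k. \<alpha> i * x ^ i * y ^ (k - i))"

text \<open>This is \<open>p(t,1) + p(1,1-t) + p(1-t,t)\<close> for \<open>p(x,y) = x^i y^j\<close>.\<close>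
definition three_term :: "nat \<Rightarrow> nat \<Rightarrow> rat poly" where
  "three_term i j = [:0, 1:] ^ i + [:1, -1:] ^ j + [:1, -1:] ^ i * [:0, 1:] ^ j"

lemma poly_eqI_poly:
  fixes p q :: "'a :: {idom, ring_char_0} poly"
  shows "(\<And>x. poly p x = poly q x) \<Longrightarrow> p = q"
  by (simp add: fun_eq_iff flip: poly_eq_poly_eq_iff)

text \<open>The orders are multiplicities of roots, and the multiset of all roots has at most
  \<open>degree p\<close> elements.\<close>

lemma sum_order_le_degree:
  fixes p :: "'a :: idom poly"
  assumes "finite A" "p \<noteq> 0"
  shows "(\<Sum>a\<in>A. Polynomial.order a p) \<le> Polynomial.degree p"
proof -
  have "(\<Sum>a\<in>A. Polynomial.order a p) = (\<Sum>a\<in>A \<inter> set_mset (proots p). count (proots p) a)"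
    using assms by (intro sum.mono_neutral_cong_right) (auto simp: order_root)
  also have "\<dots> \<le> (\<Sum>a\<in>set_mset (proots p). count (proots p) a)"
    by (intro sum_mono2) auto
  also have "\<dots> = size (proots p)" by (simp add: size_multiset_overloaded_eq)
  also have "\<dots> \<le> Polynomial.degree p" by (rule size_proots_le)
  finally show ?thesis .
qed

text \<open>The homogeneous form \<open>p(x,y) + p(y,y-x) + p(y-x,x)\<close> is alternating under the symmetric
  group permuting \<open>x\<close>, \<open>-y\<close>, \<open>y-x\<close>. If it vanishes to order \<open>m\<close> on \<open>x = 0\<close>, it does so on
  \<open>y = 0\<close> and \<open>x = y\<close>; it also vanishes on the three reflection lines, so \<open>3m + 3 \<le> k\<close>
  unless it is zero. Moreover \<open>m\<close> is odd.\<close>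
lemma three_term_sum_eq_0:
  fixes \<alpha> :: "nat \<Rightarrow> rat"
  assumes "even k"
    and odd0: "\<And>i. odd i \<Longrightarrow> \<alpha> i = 0"
    and anti: "\<And>i. i \<le> k \<Longrightarrow> \<alpha> (k - i) = - \<alpha> i"
    and g: "g = (\<Sum>i\<le>k. Polynomial.smult (\<alpha> i) (three_term i (k - i)))"
    and coeff0: "\<And>j. j < k div 6 \<Longrightarrow> Polynomial.coeff g (2 * j + 1) = 0"
  shows "g = 0"
proof (rule ccontr)
  assume "g \<noteq> 0"
  define H where "H = binary_form k \<alpha>"
  \<comment> \<open>\<open>G\<close> is the three-term expression and \<open>g\<close> its
    restriction to \<open>y = 1\<close>. The facts \<open>G_swap\<close>, \<open>G_x\<close> and
    \<open>G_y\<close> express its sign change under the three reflections.\<close>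
  define G where "G x y = H x y + H y (y - x) + H (y - x) x" for x y
  have H_neg1: "H (- x) y = H x y" for x y
    unfolding H_def binary_form_def by (intro sum.cong refl) (metis odd0 mult_zero_left power_minus_even)
  have H_neg2: "H x (- y) = H x y" for x y
    unfolding H_def binary_form_def
  proof (intro sum.cong refl)
    fix i assume "i \<in> {..k}"
    then show "\<alpha> i * x ^ i * (- y) ^ (k - i) = \<alpha> i * x ^ i * y ^ (k - i)"
      using \<open>even k\<close> odd0[of i] by (cases "even i") auto
  qed
  have H_swap: "H y x = - H x y" for x y
  proof -
    have "H y x = (\<Sum>i\<le>k. \<alpha> (k - i) * y ^ (k - i) * x ^ (k - (k - i)))"
      unfolding H_def binary_form_def
      by (rule sum.reindex_bij_witness[of _ "\<lambda>i. k - i" "\<lambda>i. k - i"]) auto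
    also have "\<dots> = (\<Sum>i\<le>k. - (\<alpha> i * x ^ i * y ^ (k - i)))"
      by (intro sum.cong refl) (simp add: anti)
    finally show ?thesis by (simp add: H_def binary_form_def sum_negf)
  qed
  have H_scale: "H (c * x) (c * y) = c ^ k * H x y" for c x y
    unfolding H_def binary_form_def sum_distrib_left
  proof (intro sum.cong refl)
    fix i assume "i \<in> {..k}"
    then have "c ^ k = c ^ i * c ^ (k - i)" by (simp flip: power_add)
    then show "\<alpha> i * (c * x) ^ i * (c * y) ^ (k - i) = c ^ k * (\<alpha> i * x ^ i * y ^ (k - i))"
      by (simp add: power_mult_distrib)
  qed
  have H_diff: "H (x - y) z = H (y - x) z" "H z (x - y) = H z (y - x)" for x y z
    using H_neg1[of "y - x" z] H_neg2[of z "y - x"] by simp_all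
  have G_swap: "G y x = - G x y" for x y
    using H_swap[of x y] H_swap[of x "y - x"] H_swap[of y "y - x"]
    by (simp add: G_def H_diff[of x y])
  have G_x: "G x (x - y) = - G x y" for x y
    using H_swap[of x y] H_swap[of x "y - x"] H_swap[of y "y - x"]
    by (simp add: G_def H_diff[of x y] H_neg1 H_neg2)
  have G_y: "G (y - x) y = - G x y" for x y
    using H_swap[of x y] H_swap[of x "y - x"] H_swap[of y "y - x"]
    by (simp add: G_def H_diff[of x y] H_neg1 H_neg2)
  have G_scale: "G (c * x) (c * y) = c ^ k * G x y" for c x y
    unfolding G_def by (simp add: H_scale distrib_left flip: right_diff_distrib)
  have poly_g: "poly g x = G x 1" for x
    unfolding g G_def H_def binary_form_def three_term_def
    by (simp add: poly_sum sum.distrib algebra_simps)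
  have deg_g: "Polynomial.degree g \<le> k"
  proof -
    have l: "Polynomial.degree ([:0, 1 :: rat:] ^ i) = i" "Polynomial.degree ([:1, - 1 :: rat:] ^ i) = i" for i
      by (simp_all add: degree_power_eq)
    have "Polynomial.degree (three_term i (k - i)) \<le> k" if "i \<le> k" for i
      unfolding three_term_def using that
      by (intro degree_add_le order.trans[OF degree_mult_le]) (auto simp: l)
    then show ?thesis
      unfolding g by (intro degree_sum_le) (auto intro: order.trans[OF degree_smult_le])
  qed
  have poly_g_sum: "poly g x = (\<Sum>i\<le>k. Polynomial.coeff g i * x ^ i)" for x
    unfolding poly_altdef using deg_g
    by (intro sum.mono_neutral_left) (auto simp: coeff_eq_0)
  define m where "m = Polynomial.order 0 g"
  have dvd0: "[:0, 1:] ^ m dvd g" using order_1[of 0 g] by (simp add: m_def)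
  then obtain h where h: "g = [:0, 1:] ^ m * h" ..
  \<comment> \<open>On \<open>y = 1\<close> the reflection \<open>G_y\<close> sends \<open>t\<close>
    to \<open>1 - t\<close> and so carries the zero at 0 to a zero at 1.\<close>
  have order1: "m \<le> Polynomial.order 1 g"
  proof -
    have "- g = [:1, -1:] ^ m * pcompose h [:1, -1:]"
    proof (rule poly_eqI_poly)
      fix x
      have "- poly g x = poly g (1 - x)" by (simp add: poly_g G_y[of 1 x])
      also have "\<dots> = (1 - x) ^ m * poly h (1 - x)" by (simp add: h)
      finally show "poly (- g) x = poly ([:1, -1:] ^ m * pcompose h [:1, -1:]) x"
        by (simp add: poly_pcompose)
    qed
    then have "[:1, -1:] ^ m dvd g" by (metis dvd_minus_iff dvd_triv_left)
    moreover have "[:- 1, 1 :: rat:] ^ m dvd [:1, -1:] ^ m"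
    proof (rule dvd_power_same)
      have "[:1, -1 :: rat:] = [:-1, 1:] * [:-1:]" by simp
      then show "[:- 1, 1 :: rat:] dvd [:1, -1:]" by (rule dvdI)
    qed
    ultimately show ?thesis using \<open>g \<noteq> 0\<close> by (metis dvd_trans order_divides)
  qed
  \<comment> \<open>The swap gives \<open>x^k g(1/x) = - g(x)\<close>, so the degree drop, which is
    the order at infinity, equals the order at 0. The extra factor \<open>[:0, 1:]\<close> takes
    care of the point 0 and is cancelled afterwards.\<close>
  have deg: "Polynomial.degree g + m = k"
  proof -
    define e where "e = k - Polynomial.degree g"
    have "[:0, 1:] * (monom 1 e * reflect_poly g) = [:0, 1:] * (- g)"
    proof (rule poly_eqI_poly)
      fix x :: rat
      show "poly ([:0, 1:] * (monom 1 e * reflect_poly g)) x = poly ([:0, 1:] * (- g)) x"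
      proof (cases "x = 0")
        case False
        have "x ^ e * (x ^ Polynomial.degree g * poly g (inverse x)) = x ^ k * poly g (inverse x)"
          using deg_g by (simp add: e_def flip: power_add mult.assoc)
        also have "\<dots> = G 1 x" using G_scale[of x "inverse x" 1] False by (simp add: poly_g)
        also have "\<dots> = - poly g x" by (simp add: G_swap[of x 1] poly_g)
        finally show ?thesis using False by (simp add: poly_monom poly_reflect_poly_nz)
      qed simp
    qed
    then have eq: "monom 1 e * reflect_poly g = - g" by simp
    have "m = Polynomial.order 0 (monom 1 e * reflect_poly g)"
      by (simp add: eq m_def)
    also have "\<dots> = e + 0"
      using \<open>g \<noteq> 0\<close> by (subst order_mult) (auto simp: order_0_monom order_0I)
    finally show ?thesis using deg_g by (simp add: e_def)
  qed
  have h0: "poly h 0 \<noteq> 0"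
  proof
    assume "poly h 0 = 0"
    then obtain h' where "h = [:0, 1:] * h'" by (auto simp: poly_eq_0_iff_dvd elim!: dvdE)
    then have "g = [:- 0, 1:] ^ Suc m * h'"
      by (simp only: h power_Suc minus_zero mult.assoc mult.left_commute)
    then have "[:- 0, 1:] ^ Suc m dvd g" by (rule dvdI)
    then show False using \<open>g \<noteq> 0\<close> unfolding order_divides m_def by simp
  qed
  have coeff_g: "Polynomial.coeff g i = (if i < m then 0 else Polynomial.coeff h (i - m))" for i
    unfolding h by (simp add: coeff_monom_mult flip: monom_altdef[of 1, simplified])
  have low: "Polynomial.coeff g i = 0" if "i < m" for i using that by (simp add: coeff_g)
  have lead: "Polynomial.coeff g m \<noteq> 0" using h0 by (simp add: coeff_g poly_0_coeff_0)
  \<comment> \<open>The reflection \<open>G_x\<close> gives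
    \<open>(x - 1)^k g(x / (x - 1)) = - g(x)\<close>. Comparing the lowest coefficients, those of
    \<open>x^m\<close>, yields \<open>(-1)^(k - m) = -1\<close>.\<close>
  have "odd m"
  proof -
    define q where "q = (\<Sum>i\<le>k. Polynomial.smult (Polynomial.coeff g i) (monom 1 i * [:-1, 1:] ^ (k - i)))"
    have "[:-1, 1:] * q = [:-1, 1:] * (- g)"
    proof (rule poly_eqI_poly)
      fix x :: rat
      show "poly ([:-1, 1:] * q) x = poly ([:-1, 1:] * (- g)) x"
      proof (cases "x = 1")
        case False
        have "poly q x = (\<Sum>i\<le>k. Polynomial.coeff g i * x ^ i * (x - 1) ^ (k - i))"
          by (simp add: q_def poly_sum poly_monom algebra_simps)
        also have "\<dots> = (\<Sum>i\<le>k. (x - 1) ^ k * (Polynomial.coeff g i * (x / (x - 1)) ^ i))"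
          using False by (intro sum.cong) (auto simp: power_diff power_divide)
        also have "\<dots> = (x - 1) ^ k * poly g (x / (x - 1))"
          by (simp add: poly_g_sum sum_distrib_left)
        also have "\<dots> = G x (x - 1)"
          using G_scale[of "x - 1" "x / (x - 1)" 1] False by (simp add: poly_g)
        also have "\<dots> = - poly g x" by (simp add: G_x poly_g)
        finally show ?thesis by simp
      qed simp
    qed
    then have "q = - g" by (subst (asm) mult_cancel_left) simp
    have "Polynomial.coeff q m = (\<Sum>i\<le>k. if i = m then Polynomial.coeff g m * (-1) ^ (k - m) else 0)"
      unfolding q_def coeff_sum
    proof (intro sum.cong refl)
      fix i
      show "Polynomial.coeff (Polynomial.smult (Polynomial.coeff g i) (monom 1 i * [:- 1, 1:] ^ (k - i))) m
          = (if i = m then Polynomial.coeff g m * (- 1) ^ (k - m) else 0)"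
        using low[of i] by (auto simp: coeff_monom_mult coeff_0_power)
    qed
    also have "\<dots> = Polynomial.coeff g m * (-1) ^ (k - m)" using deg by simp
    finally have "Polynomial.coeff g m * (-1) ^ (k - m) = - Polynomial.coeff g m" using \<open>q = - g\<close> by simp
    then have "odd (k - m)" using lead neg_one_even_power[of "k - m", where ?'a = rat] by fastforce
    then show ?thesis using \<open>even k\<close> by auto
  qed
  then obtain j where j: "m = 2 * j + 1" by (auto elim: oddE)
  \<comment> \<open>All coefficients of odd index below \<open>2 * (k div 6)\<close> vanish, while
    the one of odd index \<open>m\<close> does not.\<close>
  have "k div 6 \<le> j"
    using coeff0[of j] lead j by force
  \<comment> \<open>The points \<open>(-1, 1)\<close> and \<open>(1/2, 1)\<close> are fixed up to
    sign by reflections under which \<open>G\<close> changes sign, and \<open>k\<close> is even; 2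
    is the mirror image of -1 under \<open>t\<close> going to \<open>1 - t\<close>.\<close>
  have roots: "poly g (-1) = 0" "poly g 2 = 0" "poly g (1/2) = 0"
    using G_swap[of 1 "-1"] G_scale[of "-1" "-1" 1] G_y[of 1 2] G_y[of 1 "1/2"] \<open>even k\<close>
    by (simp_all add: poly_g)
  define A where "A = {0, 1, -1, 2, 1/2 :: rat}"
  have "(\<Sum>a\<in>A. Polynomial.order a g) \<le> Polynomial.degree g"
    by (rule sum_order_le_degree) (auto simp: A_def \<open>g \<noteq> 0\<close>)
  moreover have "(\<Sum>a\<in>A. Polynomial.order a g) = m + Polynomial.order 1 g
      + Polynomial.order (-1) g + Polynomial.order 2 g + Polynomial.order (1/2) g"
    by (simp add: A_def m_def)
  moreover have "Polynomial.order (-1) g \<noteq> 0" "Polynomial.order 2 g \<noteq> 0"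
      "Polynomial.order (1/2) g \<noteq> 0"
    using roots \<open>g \<noteq> 0\<close> by (simp_all add: order_root)
  \<comment> \<open>The orders add up to at least \<open>2 * m + 3\<close>, and the degree is
    \<open>k - m\<close>. But \<open>m = 2 * j + 1\<close> with \<open>k div 6 \<le> j\<close> makes
    \<open>3 * m + 3\<close> exceed \<open>k\<close>.\<close>
  ultimately have "3 * m + 3 \<le> k" using order1 deg by linarith
  then show False using \<open>k div 6 \<le> j\<close> j by simp
qed

section \<open>Substitution in polynomials\<close>

abbreviation qconst :: "rat \<Rightarrow> qpoly" where
  "qconst c \<equiv> Poly_Mapping.single 0 c"

definition mono_subst :: "(nat \<Rightarrow> qpoly) \<Rightarrow> (nat \<Rightarrow>\<^sub>0 nat) \<Rightarrow> qpoly" where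
  "mono_subst \<sigma> m = (\<Prod>i\<in>Poly_Mapping.keys m. \<sigma> i ^ Poly_Mapping.lookup m i)"

text \<open>The ring homomorphism sending \<open>qvar i\<close> to \<open>\<sigma> i\<close>. It
  serves for sign changes, setting variables to zero, scaling and shifting alike.\<close>

definition qsubst :: "(nat \<Rightarrow> qpoly) \<Rightarrow> qpoly \<Rightarrow> qpoly" where
  "qsubst \<sigma> p = (\<Sum>m\<in>Poly_Mapping.keys p. qconst (Poly_Mapping.lookup p m) * mono_subst \<sigma> m)"

lemma mono_subst_superset:
  assumes "finite A" "Poly_Mapping.keys m \<subseteq> A"
  shows "mono_subst \<sigma> m = (\<Prod>i\<in>A. \<sigma> i ^ Poly_Mapping.lookup m i)"
  unfolding mono_subst_def using assms
  by (intro prod.mono_neutral_left) (auto simp: in_keys_iff)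

lemma mono_subst_add: "mono_subst \<sigma> (m + m') = mono_subst \<sigma> m * mono_subst \<sigma> m'"
proof -
  let ?A = "Poly_Mapping.keys m \<union> Poly_Mapping.keys m'"
  have "mono_subst \<sigma> (m + m') = (\<Prod>i\<in>?A. \<sigma> i ^ Poly_Mapping.lookup (m + m') i)"
    using Poly_Mapping.keys_add[of m m'] by (intro mono_subst_superset) auto
  also have "\<dots> = (\<Prod>i\<in>?A. \<sigma> i ^ Poly_Mapping.lookup m i) * (\<Prod>i\<in>?A. \<sigma> i ^ Poly_Mapping.lookup m' i)"
    by (simp add: lookup_add power_add prod.distrib)
  finally show ?thesis by (simp add: mono_subst_superset[of ?A])
qed

lemma qsubst_superset:
  assumes "finite A" "Poly_Mapping.keys p \<subseteq> A"
  shows "qsubst \<sigma> p = (\<Sum>m\<in>A. qconst (Poly_Mapping.lookup p m) * mono_subst \<sigma> m)"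
  unfolding qsubst_def using assms
  by (intro sum.mono_neutral_left) (auto simp: in_keys_iff)

lemma qsubst_0 [simp]: "qsubst \<sigma> 0 = 0"
  by (simp add: qsubst_def)

lemma qsubst_add: "qsubst \<sigma> (p + q) = qsubst \<sigma> p + qsubst \<sigma> q"
proof -
  let ?A = "Poly_Mapping.keys p \<union> Poly_Mapping.keys q"
  have "qsubst \<sigma> (p + q) = (\<Sum>m\<in>?A. qconst (Poly_Mapping.lookup (p + q) m) * mono_subst \<sigma> m)"
    using Poly_Mapping.keys_add[of p q] by (intro qsubst_superset) auto
  also have "\<dots> = (\<Sum>m\<in>?A. qconst (Poly_Mapping.lookup p m) * mono_subst \<sigma> m)
      + (\<Sum>m\<in>?A. qconst (Poly_Mapping.lookup q m) * mono_subst \<sigma> m)"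
    by (simp add: lookup_add single_add distrib_right sum.distrib)
  finally show ?thesis by (simp add: qsubst_superset[of ?A])
qed

lemma qsubst_sum: "qsubst \<sigma> (\<Sum>x\<in>X. p x) = (\<Sum>x\<in>X. qsubst \<sigma> (p x))"
  by (induction X rule: infinite_finite_induct) (simp_all add: qsubst_add)

lemma qsubst_single: "qsubst \<sigma> (Poly_Mapping.single m c) = qconst c * mono_subst \<sigma> m"
  by (cases "c = 0") (simp_all add: qsubst_def)

lemma sum_monomials: "p = (\<Sum>m\<in>Poly_Mapping.keys p. Poly_Mapping.single m (Poly_Mapping.lookup p m))"
proof (rule poly_mapping_eqI)
  fix k
  have "Poly_Mapping.lookup (\<Sum>m\<in>Poly_Mapping.keys p. Poly_Mapping.single m (Poly_Mapping.lookup p m)) k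
      = (\<Sum>m\<in>Poly_Mapping.keys p. if m = k then Poly_Mapping.lookup p m else 0)"
    by (simp add: lookup_sum lookup_single when_def)
  also have "\<dots> = Poly_Mapping.lookup p k" by (simp add: in_keys_iff)
  finally show "Poly_Mapping.lookup p k = Poly_Mapping.lookup (\<Sum>m\<in>Poly_Mapping.keys p. Poly_Mapping.single m (Poly_Mapping.lookup p m)) k" by simp
qed

lemma qsubst_mult: "qsubst \<sigma> (p * q) = qsubst \<sigma> p * qsubst \<sigma> q"
proof -
  have mono: "qsubst \<sigma> (Poly_Mapping.single m a * Poly_Mapping.single m' b)
      = qsubst \<sigma> (Poly_Mapping.single m a) * qsubst \<sigma> (Poly_Mapping.single m' b)" for m m' a b
  proof -
    have "qconst (a * b) = qconst a * qconst b" by (simp add: mult_single)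
    then show ?thesis by (simp add: mult_single qsubst_single mono_subst_add)
  qed
  have "p * q = (\<Sum>m\<in>Poly_Mapping.keys p. \<Sum>m'\<in>Poly_Mapping.keys q.
      Poly_Mapping.single m (Poly_Mapping.lookup p m) * Poly_Mapping.single m' (Poly_Mapping.lookup q m'))"
    by (subst sum_monomials[of p], subst sum_monomials[of q]) (simp add: sum_product)
  then have "qsubst \<sigma> (p * q) = (\<Sum>m\<in>Poly_Mapping.keys p. qsubst \<sigma> (Poly_Mapping.single m (Poly_Mapping.lookup p m)))
      * (\<Sum>m'\<in>Poly_Mapping.keys q. qsubst \<sigma> (Poly_Mapping.single m' (Poly_Mapping.lookup q m')))"
    by (simp add: qsubst_sum mono sum_product)
  also have "\<dots> = qsubst \<sigma> p * qsubst \<sigma> q"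
    by (simp add: sum_monomials[symmetric] flip: qsubst_sum)
  finally show ?thesis .
qed

lemma qsubst_const [simp]: "qsubst \<sigma> (qconst c) = qconst c"
  by (simp add: qsubst_single mono_subst_def)

lemma qsubst_1 [simp]: "qsubst \<sigma> 1 = 1"
  using qsubst_const[of \<sigma> 1] by simp

lemma qsubst_qvar [simp]: "qsubst \<sigma> (qvar i) = \<sigma> i"
  by (simp add: qvar_def qsubst_single mono_subst_def)

lemma qsubst_uminus: "qsubst \<sigma> (- p) = - qsubst \<sigma> p"
  using qsubst_add[of \<sigma> p "- p"] by (simp add: minus_unique)

lemma qsubst_diff: "qsubst \<sigma> (p - q) = qsubst \<sigma> p - qsubst \<sigma> q"
  using qsubst_add[of \<sigma> p "- q"] by (simp add: qsubst_uminus)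

lemma qsubst_power: "qsubst \<sigma> (p ^ n) = qsubst \<sigma> p ^ n"
  by (induction n) (simp_all add: qsubst_mult)

lemmas qsubst_hom = qsubst_add qsubst_diff qsubst_uminus qsubst_mult qsubst_power qsubst_sum

lemma single_var_power:
  "Poly_Mapping.single (Poly_Mapping.single j (Suc 0)) (c :: rat) ^ e
    = Poly_Mapping.single (Poly_Mapping.single j e) (c ^ e)"
  by (induction e) (simp_all add: mult_single flip: single_add)

lemma qvar_power: "qvar i ^ e = Poly_Mapping.single (Poly_Mapping.single i e) 1"
  by (simp add: qvar_def single_var_power)

lemma prod_single:
  "(\<Prod>i\<in>A. Poly_Mapping.single (f i) (g i :: rat)) = Poly_Mapping.single (\<Sum>i\<in>A. f i :: nat \<Rightarrow>\<^sub>0 nat) (\<Prod>i\<in>A. g i)"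
  by (induction A rule: infinite_finite_induct) (simp_all add: mult_single)

text \<open>A diagonal substitution multiplies each monomial by a scalar. Evenness, divisibility by
  a variable and homogeneity thereby become conditions on single coefficients, with factors -1, 0
  and 2.\<close>

lemma lookup_qsubst_scale:
  "Poly_Mapping.lookup (qsubst (\<lambda>i. qconst (c i) * qvar i) p) k = (\<Prod>i\<in>Poly_Mapping.keys k. c i ^ Poly_Mapping.lookup k i) * Poly_Mapping.lookup p k"
proof -
  have "qsubst (\<lambda>i. qconst (c i) * qvar i) p
      = (\<Sum>m\<in>Poly_Mapping.keys p. Poly_Mapping.single m (Poly_Mapping.lookup p m * (\<Prod>i\<in>Poly_Mapping.keys m. c i ^ Poly_Mapping.lookup m i)))"
    unfolding qsubst_def mono_subst_def
    by (simp add: qvar_def mult_single single_var_power prod_single flip: sum_monomials)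
  then show ?thesis
    by (simp add: lookup_sum lookup_single when_def in_keys_iff)
qed

lemma lookup_qconst_mult [simp]: "Poly_Mapping.lookup (qconst c * p) k = c * Poly_Mapping.lookup p k"
proof -
  have "Poly_Mapping.lookup (qconst c * p) k = (\<Sum>m\<in>Poly_Mapping.keys p. Poly_Mapping.lookup (Poly_Mapping.single m (c * Poly_Mapping.lookup p m)) k)"
    by (subst sum_monomials[of p]) (simp add: sum_distrib_left mult_single lookup_sum)
  also have "\<dots> = c * Poly_Mapping.lookup p k"
    by (simp add: lookup_single when_def in_keys_iff)
  finally show ?thesis .
qed

lemma qconst_power: "qconst (t ^ n) = qconst t ^ n"
  by (induction n) (simp_all add: mult_single[of 0 _ 0, simplified, symmetric])

lemma expvec_3: "expvec [i, j, l]
    = Poly_Mapping.single 0 i + Poly_Mapping.single 1 j + Poly_Mapping.single 2 l"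
  by (simp add: expvec_def upt_rec numeral_2_eq_2 add.assoc)

lemma expvec_2: "expvec [i, j] = Poly_Mapping.single 0 i + Poly_Mapping.single 1 j"
  by (simp add: expvec_def upt_rec)

lemma mono_subst_shift:
  "mono_subst (\<lambda>i. qvar (Suc i)) m
    = Poly_Mapping.single (\<Sum>i\<in>Poly_Mapping.keys m. Poly_Mapping.single (Suc i) (Poly_Mapping.lookup m i)) 1"
  unfolding mono_subst_def by (simp add: qvar_def single_var_power prod_single)

lemma lookup_shift:
  "Poly_Mapping.lookup (\<Sum>i\<in>Poly_Mapping.keys m. Poly_Mapping.single (Suc i) (Poly_Mapping.lookup m i :: nat)) (Suc j) = Poly_Mapping.lookup m j"
  "Poly_Mapping.lookup (\<Sum>i\<in>Poly_Mapping.keys m. Poly_Mapping.single (Suc i) (Poly_Mapping.lookup m i :: nat)) 0 = 0"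
  by (simp_all add: lookup_sum lookup_single when_def in_keys_iff)

text \<open>Multiplying by a power of the first variable after moving all variables up by one
  realises the Kronecker delta on the first entries in \<open>E2\<close>.\<close>

lemma lookup_mult_qvar0_shift:
  "Poly_Mapping.lookup (qvar 0 ^ e * qsubst (\<lambda>i. qvar (Suc i)) p) (expvec [e', i, j])
    = (if e = e' then Poly_Mapping.lookup p (expvec [i, j]) else 0)"
proof -
  define s where "s m = (\<Sum>i\<in>Poly_Mapping.keys m. Poly_Mapping.single (Suc i) (Poly_Mapping.lookup m i :: nat))"
    for m :: "nat \<Rightarrow>\<^sub>0 nat"
  have s_at: "Poly_Mapping.lookup (s m) (Suc t) = Poly_Mapping.lookup m t"
      "Poly_Mapping.lookup (s m) 0 = 0" for m t
    by (simp_all add: s_def lookup_shift)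
  have iff: "Poly_Mapping.single 0 e + s m = expvec [e', i, j] \<longleftrightarrow> e = e' \<and> m = expvec [i, j]" for m
  proof
    assume *: "Poly_Mapping.single 0 e + s m = expvec [e', i, j]"
    have at: "Poly_Mapping.lookup (Poly_Mapping.single 0 e + s m) t = Poly_Mapping.lookup (expvec [e', i, j]) t" for t
      by (simp add: *)
    have "Poly_Mapping.lookup m t = Poly_Mapping.lookup (expvec [i, j]) t" for t
      using at[of "Suc t"] by (auto simp: lookup_add s_at expvec_2 expvec_3 lookup_single when_def)
    moreover have "e = e'" using at[of 0] by (simp add: lookup_add s_at expvec_3 lookup_single when_def)
    ultimately show "e = e' \<and> m = expvec [i, j]" by (auto intro: poly_mapping_eqI)
  next
    assume *: "e = e' \<and> m = expvec [i, j]"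
    show "Poly_Mapping.single 0 e + s m = expvec [e', i, j]"
    proof (rule poly_mapping_eqI)
      fix t
      show "Poly_Mapping.lookup (Poly_Mapping.single 0 e + s m) t = Poly_Mapping.lookup (expvec [e', i, j]) t"
        using * by (cases t) (auto simp: lookup_add s_at expvec_2 expvec_3 lookup_single when_def)
    qed
  qed
  have "qvar 0 ^ e * qsubst (\<lambda>i. qvar (Suc i)) p
      = (\<Sum>m\<in>Poly_Mapping.keys p. Poly_Mapping.single (Poly_Mapping.single 0 e + s m) (Poly_Mapping.lookup p m))"
    by (simp add: qsubst_def mono_subst_shift qvar_power mult_single sum_distrib_left s_def)
  then have "Poly_Mapping.lookup (qvar 0 ^ e * qsubst (\<lambda>i. qvar (Suc i)) p) (expvec [e', i, j])
      = (\<Sum>m\<in>Poly_Mapping.keys p. if e = e' \<and> m = expvec [i, j] then Poly_Mapping.lookup p m else 0)"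
    by (simp add: lookup_sum lookup_single when_def iff)
  also have "\<dots> = (if e = e' then Poly_Mapping.lookup p (expvec [i, j]) else 0)"
    by (auto simp: in_keys_iff)
  finally show ?thesis .
qed

section \<open>Even forms in three variables\<close>

lemma finite_Sset [simp]: "finite (Sset N r)"
proof (rule finite_subset)
  show "Sset N r \<subseteq> {xs. set xs \<subseteq> {..N} \<and> length xs = r}"
    by (auto simp: Sset_def member_le_sum_list)
  show "finite {xs. set xs \<subseteq> {..N} \<and> length xs = r}"
    by (rule finite_lists_length_eq) simp
qed

lemma set_Slist [simp]: "set (Slist N r) = Sset N r"
  and distinct_Slist: "distinct (Slist N r)"
  by (simp_all add: Slist_def)

lemma sum_Slist: "(\<Sum>p<sdim N r. h (Slist N r ! p)) = (\<Sum>ns\<in>Sset N r. h ns)"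
  using sum.reindex_bij_betw[OF bij_betw_nth[OF distinct_Slist refl refl], of h N r]
  by (simp add: sdim_def)

lemma Slist_nth_mem: "q < sdim N r \<Longrightarrow> Slist N r ! q \<in> Sset N r"
  unfolding sdim_def by (metis nth_mem set_Slist)

lemma length_3_conv: "length xs = 3 \<longleftrightarrow> (\<exists>a b c. xs = [a, b, c])"
  by (auto simp: numeral_3_eq_3 length_Suc_conv)

lemma Sset3_E:
  assumes "ns \<in> Sset N 3"
  obtains a b c where "ns = [a, b, c]" "odd a" "odd b" "odd c" "3 \<le> a" "3 \<le> b" "3 \<le> c"
    "a + b + c = N"
  using assms by (auto simp: Sset_def length_3_conv)

lemma Sset3_iff [simp]: "[a, b, c] \<in> Sset N 3 \<longleftrightarrow>
    odd a \<and> odd b \<and> odd c \<and> 3 \<le> a \<and> 3 \<le> b \<and> 3 \<le> c \<and> a + b + c = N"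
  by (auto simp: Sset_def)

text \<open>The polynomial with coefficients \<open>f\<close>, evaluated at three polynomials. With
  the arguments as parameters, every substitution is just a change of arguments.\<close>

definition form3 :: "nat \<Rightarrow> (nat list \<Rightarrow> rat) \<Rightarrow> qpoly \<Rightarrow> qpoly \<Rightarrow> qpoly \<Rightarrow> qpoly" where
  "form3 N f a b c = (\<Sum>ns\<in>Sset N 3. qconst (f ns) *
     (a ^ (ns ! 0 - 1) * b ^ (ns ! 1 - 1) * c ^ (ns ! 2 - 1)))"

definition coeff_at :: "nat list \<Rightarrow> qpoly \<Rightarrow> rat" where
  "coeff_at ns p = Poly_Mapping.lookup p (expvec (map (\<lambda>k. k - 1) ns))"

lemma coeff_at_linear:
  "coeff_at ns (p + q) = coeff_at ns p + coeff_at ns q"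
  "coeff_at ns (p - q) = coeff_at ns p - coeff_at ns q"
  "coeff_at ns (- p) = - coeff_at ns p"
  "coeff_at ns 0 = 0"
  by (simp_all add: coeff_at_def lookup_add lookup_minus)

lemma qsubst_form3:
  "qsubst \<sigma> (form3 N f a b c) = form3 N f (qsubst \<sigma> a) (qsubst \<sigma> b) (qsubst \<sigma> c)"
  by (simp add: form3_def qsubst_hom)

text \<open>Entries of an index are odd and at least 3, so only even positive powers of the
  arguments occur.\<close>

lemma form3_cong_powers:
  assumes "\<And>k. even k \<Longrightarrow> 0 < k \<Longrightarrow> a ^ k = a' ^ k" "\<And>k. even k \<Longrightarrow> 0 < k \<Longrightarrow> b ^ k = b' ^ k"
    "\<And>k. even k \<Longrightarrow> 0 < k \<Longrightarrow> c ^ k = c' ^ k"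
  shows "form3 N f a b c = form3 N f a' b' c'"
  unfolding form3_def using assms
  by (intro sum.cong refl arg_cong2[of _ _ _ _ "(*)"]) (auto elim!: Sset3_E)

lemma form3_neg [simp]:
  "form3 N f (- a) b c = form3 N f a b c"
  "form3 N f a (- b) c = form3 N f a b c"
  "form3 N f a b (- c) = form3 N f a b c"
  by (rule form3_cong_powers; simp)+

lemma form3_diff_commute:
  "form3 N f (a - a') b c = form3 N f (a' - a) b c"
  "form3 N f b (a - a') c = form3 N f b (a' - a) c"
  "form3 N f b c (a - a') = form3 N f b c (a' - a)"
  using form3_neg(1)[of N f "a' - a" b c] form3_neg(2)[of N f b "a' - a" c]
    form3_neg(3)[of N f b c "a' - a"] by simp_all

lemma form3_0 [simp]:
  "form3 N f 0 b c = 0" "form3 N f a 0 c = 0" "form3 N f a b 0 = 0"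
  unfolding form3_def by (rule sum.neutral; auto elim!: Sset3_E simp: zero_power)+

lemma form3_scale:
  "form3 N f (qconst t * a) (qconst t * b) (qconst t * c) = qconst (t ^ (N - 3)) * form3 N f a b c"
  unfolding form3_def sum_distrib_left
proof (intro sum.cong refl)
  fix ns assume "ns \<in> Sset N 3"
  then obtain i j l where *: "ns = [i, j, l]" "3 \<le> i" "3 \<le> j" "3 \<le> l" "i + j + l = N"
    by (elim Sset3_E)
  then have "N - 3 = (i - 1) + (j - 1) + (l - 1)" by simp
  then have "qconst (t ^ (N - 3)) = qconst t ^ (i - 1) * qconst t ^ (j - 1) * qconst t ^ (l - 1)"
    by (simp add: qconst_power flip: power_add)
  then show "qconst (f ns) * ((qconst t * a) ^ (ns ! 0 - 1) * (qconst t * b) ^ (ns ! 1 - 1)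
      * (qconst t * c) ^ (ns ! 2 - 1))
    = qconst (t ^ (N - 3)) * (qconst (f ns) * (a ^ (ns ! 0 - 1) * b ^ (ns ! 1 - 1) * c ^ (ns ! 2 - 1)))"
    using * by (simp add: power_mult_distrib algebra_simps)
qed

lemma expvec_3_eq_iff: "expvec [i, j, l] = expvec [i', j', l'] \<longleftrightarrow> i = i' \<and> j = j' \<and> l = l'"
proof
  assume *: "expvec [i, j, l] = expvec [i', j', l']"
  have "Poly_Mapping.lookup (expvec [i, j, l]) t = Poly_Mapping.lookup (expvec [i', j', l']) t" for t
    by (simp add: *)
  from this[of 0] this[of 1] this[of 2] show "i = i' \<and> j = j' \<and> l = l'"
    by (simp add: expvec_3 lookup_add lookup_single when_def)
qed simp

abbreviation "X \<equiv> qvar 0"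
abbreviation "Y \<equiv> qvar (Suc 0)"
abbreviation "Z \<equiv> qvar 2"

lemma form3_vars: "form3 N f X Y Z
    = (\<Sum>ns\<in>Sset N 3. Poly_Mapping.single (expvec (map (\<lambda>k. k - 1) ns)) (f ns))"
  unfolding form3_def
  by (intro sum.cong refl) (auto elim!: Sset3_E simp: qvar_power mult_single expvec_3)

lemma coeff_at_form3_vars:
  assumes "ns \<in> Sset N 3"
  shows "coeff_at ns (form3 N f X Y Z) = f ns"
proof -
  have "expvec (map (\<lambda>k. k - 1) ms) = expvec (map (\<lambda>k. k - 1) ns) \<longleftrightarrow> ms = ns"
    if "ms \<in> Sset N 3" for ms
    using that assms by (auto elim!: Sset3_E simp: expvec_3_eq_iff)
  then have "coeff_at ns (form3 N f X Y Z) = (\<Sum>ms\<in>Sset N 3. if ms = ns then f ms else 0)"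
    unfolding form3_vars coeff_at_def lookup_sum
    by (intro sum.cong refl) (simp add: lookup_single when_def)
  then show ?thesis using assms by simp
qed

text \<open>The monomial read off is even in every variable, hence its coefficient does not see the
  sign change.\<close>

lemma coeff_at_flip:
  assumes "ns \<in> Sset N 3"
  shows "coeff_at ns (qsubst (\<lambda>j. if j = i then - qvar j else qvar j) p) = coeff_at ns p"
proof -
  define c :: "nat \<Rightarrow> rat" where "c j = (if j = i then -1 else 1)" for j
  have "qsubst (\<lambda>j. if j = i then - qvar j else qvar j) p = qsubst (\<lambda>j. qconst (c j) * qvar j) p"
    by (intro arg_cong[of _ _ "\<lambda>\<sigma>. qsubst \<sigma> p"] ext) (simp add: c_def single_uminus)
  moreover have "c j ^ Poly_Mapping.lookup (expvec (map (\<lambda>k. k - 1) ns)) j = 1" for j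
    using assms by (auto elim!: Sset3_E simp: c_def expvec_3 lookup_add lookup_single when_def)
  ultimately show ?thesis by (simp add: coeff_at_def lookup_qsubst_scale)
qed

text \<open>The monomial read off contains each of the three variables, whereas \<open>p\<close>
  does not involve variable \<open>i\<close>.\<close>

lemma coeff_at_eq_0:
  assumes "ns \<in> Sset N 3" "i < 3" "qsubst (qvar(i := 0)) p = p"
  shows "coeff_at ns p = 0"
proof -
  define c :: "nat \<Rightarrow> rat" where "c j = (if j = i then 0 else 1)" for j
  let ?k = "expvec (map (\<lambda>k. k - 1) ns)"
  have "qvar(i := 0) = (\<lambda>j. qconst (c j) * qvar j)"
    by (auto simp: c_def fun_eq_iff)
  then have "coeff_at ns p = (\<Prod>j\<in>Poly_Mapping.keys ?k. c j ^ Poly_Mapping.lookup ?k j) * coeff_at ns p"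
    using lookup_qsubst_scale[of c p ?k] assms(3) by (simp add: coeff_at_def)
  moreover have "i \<in> Poly_Mapping.keys ?k"
    using assms(1,2) by (auto elim!: Sset3_E simp: in_keys_iff expvec_3 lookup_add lookup_single when_def)
  then have "(\<Prod>j\<in>Poly_Mapping.keys ?k. c j ^ Poly_Mapping.lookup ?k j) = 0"
    by (intro prod_zero) (auto simp: c_def in_keys_iff intro!: bexI[of _ i])
  ultimately show ?thesis by (metis mult_zero_left)
qed

text \<open>Evenness, divisibility by each variable, absence of further variables and homogeneity
  are translated by \<open>lookup_qsubst_scale\<close> into conditions on exponents; together they
  leave only monomials belonging to \<open>Sset N 3\<close>.\<close>

lemma eq_form3I:
  assumes flip: "\<And>i. i < 3 \<Longrightarrow> qsubst (\<lambda>j. if j = i then - qvar j else qvar j) p = p"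
    and zero: "\<And>i. i < 3 \<Longrightarrow> qsubst (qvar(i := 0)) p = 0"
    and vars: "\<And>i. 3 \<le> i \<Longrightarrow> qsubst (qvar(i := 0)) p = p"
    and hom: "qsubst (\<lambda>j. qconst 2 * qvar j) p = qconst (2 ^ (N - 3)) * p"
    and "9 \<le> N"
  shows "p = form3 N (\<lambda>ns. coeff_at ns p) X Y Z"
proof (rule poly_mapping_eqI)
  fix k :: "nat \<Rightarrow>\<^sub>0 nat"
  let ?l = "Poly_Mapping.lookup k"
  have scale: "Poly_Mapping.lookup (qsubst (\<lambda>j. qconst (c j) * qvar j) p) k
      = (\<Prod>j\<in>Poly_Mapping.keys k. c j ^ ?l j) * Poly_Mapping.lookup p k" for c
    by (rule lookup_qsubst_scale)
  show "Poly_Mapping.lookup p k = Poly_Mapping.lookup (form3 N (\<lambda>ns. coeff_at ns p) X Y Z) k"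
  proof (cases "\<exists>ns\<in>Sset N 3. k = expvec (map (\<lambda>k. k - 1) ns)")
    case True
    then show ?thesis
      using coeff_at_form3_vars[of _ N "\<lambda>ns. coeff_at ns p"] by (auto simp: coeff_at_def)
  next
    case False
    then have "Poly_Mapping.lookup (form3 N (\<lambda>ns. coeff_at ns p) X Y Z) k = 0"
      unfolding form3_vars lookup_sum by (intro sum.neutral) (auto simp: lookup_single when_def)
    moreover have "Poly_Mapping.lookup p k = 0"
    proof (rule ccontr)
      assume nz: "Poly_Mapping.lookup p k \<noteq> 0"
      have zero_eq: "qvar(i := 0) = (\<lambda>j. qconst (if j = i then 0 else 1) * qvar j)" for i
        by (auto simp: fun_eq_iff)
      have flip_eq: "(\<lambda>j. if j = i then - qvar j else qvar j)
          = (\<lambda>j. qconst (if j = i then -1 else 1) * qvar j)" for i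
        by (auto simp: fun_eq_iff single_uminus)
      have out: "?l i = 0" if "3 \<le> i" for i
      proof (rule ccontr)
        assume "?l i \<noteq> 0"
        then have "(\<Prod>j\<in>Poly_Mapping.keys k. (if j = i then 0 else 1 :: rat) ^ ?l j) = 0"
          by (intro prod_zero) (auto simp: in_keys_iff intro!: bexI[of _ i])
        then show False using scale[of "\<lambda>j. if j = i then 0 else 1"] vars[OF that] nz
          by (simp only: zero_eq mult_zero_left)
      qed
      have pos: "?l i \<noteq> 0" if "i < 3" for i
      proof
        assume "?l i = 0"
        then have "(\<Prod>j\<in>Poly_Mapping.keys k. (if j = i then 0 else 1 :: rat) ^ ?l j) = 1"
          by (intro prod.neutral) auto
        then show False using scale[of "\<lambda>j. if j = i then 0 else 1"] zero[OF that] nz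
          by (simp add: zero_eq)
      qed
      have even: "even (?l i)" if "i < 3" for i
      proof (rule ccontr)
        assume odd: "odd (?l i)"
        have "(\<Prod>j\<in>Poly_Mapping.keys k. (if j = i then -1 else 1 :: rat) ^ ?l j)
            = (\<Prod>j\<in>{i}. (if j = i then -1 else 1 :: rat) ^ ?l j)"
          using pos[OF that] by (intro prod.mono_neutral_right) (auto simp: in_keys_iff)
        also have "\<dots> = -1" using odd by simp
        finally show False using scale[of "\<lambda>j. if j = i then -1 else 1"] flip[OF that] nz
          by (simp add: flip_eq)
      qed
      have k: "k = expvec [?l 0, ?l 1, ?l 2]"
      proof (rule poly_mapping_eqI)
        fix t
        show "?l t = Poly_Mapping.lookup (expvec [?l 0, ?l 1, ?l 2]) t"
          using out[of t] by (auto simp: expvec_3 lookup_add lookup_single when_def)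
      qed
      have keys: "Poly_Mapping.keys k = {0, 1, 2}"
      proof -
        have "t \<in> Poly_Mapping.keys k \<longleftrightarrow> t < 3" for t
          using pos[of t] out[of t] by (cases "t < 3") (simp_all add: in_keys_iff)
        then have "Poly_Mapping.keys k = {..<3}" by (simp add: set_eq_iff)
        also have "\<dots> = {0, 1, 2}" by auto
        finally show ?thesis .
      qed
      \<comment> \<open>The single scalar 2 detects the degree, because its powers are
        distinct.\<close>
      have "(2 :: rat) ^ (?l 0 + ?l 1 + ?l 2) = 2 ^ (N - 3)"
        using scale[of "\<lambda>_. 2"] hom nz by (simp add: keys power_add)
      then have total: "?l 0 + ?l 1 + ?l 2 = N - 3" by simp
      have ge2: "2 \<le> ?l i" if "i < 3" for i
        using pos[OF that] even[OF that] by (cases "?l i"; cases "?l i - 1") auto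
      have "[?l 0 + 1, ?l 1 + 1, ?l 2 + 1] \<in> Sset N 3"
        using even[of 0] even[of 1] even[of 2] ge2[of 0] ge2[of 1] ge2[of 2] total \<open>9 \<le> N\<close> by simp
      moreover have "k = expvec (map (\<lambda>k. k - 1) [?l 0 + 1, ?l 1 + 1, ?l 2 + 1])"
        by (rule trans[OF k arg_cong[of _ _ expvec]]) simp
      ultimately show False using False by blast
    qed
    ultimately show ?thesis by simp
  qed
qed

section \<open>The action of the matrices on coefficient vectors\<close>

lemma coeff_at_qconst_mult: "coeff_at ns (qconst c * p) = c * coeff_at ns p"
  by (simp add: coeff_at_def)

lemma coeff_at_sum: "coeff_at ns (\<Sum>x\<in>A. p x) = (\<Sum>x\<in>A. coeff_at ns (p x))"
  by (simp add: coeff_at_def lookup_sum)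

lemma mono_at_Cons [simp]: "mono_at (p # ps) (e # es) = p ^ e * mono_at ps es"
  and mono_at_Nil [simp]: "mono_at [] [] = 1"
  by (simp_all add: mono_at_def)

text \<open>For even \<open>a\<close> the sign \<open>(-1) ^ a\<close> disappears and differences
  may be reversed, so both terms for each \<open>i\<close> carry the same power of a
  difference.\<close>

lemma ihara_even_3:
  assumes "even a"
  shows "ihara a [b, c] = X ^ a * Y ^ b * Z ^ c + (Y - X) ^ a * X ^ b * Z ^ c - (Y - X) ^ a * Y ^ b * Z ^ c
    + (Z - Y) ^ a * X ^ b * Y ^ c - (Z - Y) ^ a * X ^ b * Z ^ c"
proof -
  have len: "Suc (length [b, c]) = 3" by simp
  have upt: "[1..<3] = [1, 2 :: nat]" "[0..<3] = [0, 1, 2 :: nat]" "{1..<3} = {1, 2 :: nat}"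
    by (auto simp: upt_rec)
  have "(X - Y) ^ a = (Y - X) ^ a" "(Y - Z) ^ a = (Z - Y) ^ a"
    using power_minus_even[OF assms, of "Y - X"] power_minus_even[OF assms, of "Z - Y"] by simp_all
  then show ?thesis using assms unfolding ihara_def Let_def len upt
    by (simp add: algebra_simps)
qed

lemma ihara_even_2:
  assumes "even a"
  shows "ihara a [b] = X ^ a * Y ^ b + (Y - X) ^ a * X ^ b - (Y - X) ^ a * Y ^ b"
proof -
  have len: "Suc (length [b]) = 2" by simp
  have upt: "[1..<2] = [1 :: nat]" "[0..<2] = [0, 1 :: nat]" "{1..<2} = {1 :: nat}"
    by (auto simp: upt_rec)
  have "(X - Y) ^ a = (Y - X) ^ a"
    using power_minus_even[OF assms, of "Y - X"] by simp_all
  then show ?thesis using assms unfolding ihara_def Let_def len upt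
    by (simp add: algebra_simps)
qed

text \<open>Row vectors are treated as functions of the index itself rather than of its position in
  \<open>Slist\<close>.\<close>

definition E_row :: "nat \<Rightarrow> (nat list \<Rightarrow> rat) \<Rightarrow> nat list \<Rightarrow> rat" where
  "E_row N f ns = (\<Sum>ms\<in>Sset N 3. f ms * ecoef ms ns)"

definition E2_row :: "nat \<Rightarrow> (nat list \<Rightarrow> rat) \<Rightarrow> nat list \<Rightarrow> rat" where
  "E2_row N f ns = (\<Sum>ms\<in>Sset N 3. f ms *
     ((if take 1 ms = take 1 ns then 1 else 0) * ecoef (drop 1 ms) (drop 1 ns)))"

lemma E_row_eq: "E_row N f ns = coeff_at ns (form3 N f X Y Z + form3 N f (Y - X) X Z
    - form3 N f (Y - X) Y Z + form3 N f (Z - Y) X Y - form3 N f (Z - Y) X Z)"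
proof -
  have "f ms * ecoef ms ns = coeff_at ns (qconst (f ms) * (X ^ (ms ! 0 - 1) * Y ^ (ms ! 1 - 1) * Z ^ (ms ! 2 - 1))
      + qconst (f ms) * ((Y - X) ^ (ms ! 0 - 1) * X ^ (ms ! 1 - 1) * Z ^ (ms ! 2 - 1))
      - qconst (f ms) * ((Y - X) ^ (ms ! 0 - 1) * Y ^ (ms ! 1 - 1) * Z ^ (ms ! 2 - 1))
      + qconst (f ms) * ((Z - Y) ^ (ms ! 0 - 1) * X ^ (ms ! 1 - 1) * Y ^ (ms ! 2 - 1))
      - qconst (f ms) * ((Z - Y) ^ (ms ! 0 - 1) * X ^ (ms ! 1 - 1) * Z ^ (ms ! 2 - 1)))"
    if ms: "ms \<in> Sset N 3" for ms
  proof -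
    obtain a b c where abc: "ms = [a, b, c]" "odd a" using ms by (elim Sset3_E)
    have "ecoef ms ns = coeff_at ns (ihara (a - 1) [b - 1, c - 1])"
      by (simp add: ecoef_def coeff_at_def abc)
    moreover have "even (a - 1)" using abc by simp
    ultimately show ?thesis
      by (simp add: abc(1) ihara_even_3 coeff_at_linear coeff_at_qconst_mult ring_distribs)
  qed
  then show ?thesis
    unfolding E_row_def form3_def sum.distrib[symmetric] sum_subtractf[symmetric] coeff_at_sum
    by (rule sum.cong[OF refl])
qed

text \<open>A power of \<open>X\<close> accounts for the equality of first entries; the rest is the
  action in two variables, shifted to \<open>Y\<close> and \<open>Z\<close>.\<close>

lemma E2_row_eq:
  assumes "ns \<in> Sset N 3"
  shows "E2_row N f ns = coeff_at ns (form3 N f X Y Z + form3 N f X (Z - Y) Y - form3 N f X (Z - Y) Z)"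
proof -
  have "f ms * ((if take 1 ms = take 1 ns then 1 else 0) * ecoef (drop 1 ms) (drop 1 ns))
    = coeff_at ns (qconst (f ms) * (X ^ (ms ! 0 - 1) * Y ^ (ms ! 1 - 1) * Z ^ (ms ! 2 - 1))
      + qconst (f ms) * (X ^ (ms ! 0 - 1) * (Z - Y) ^ (ms ! 1 - 1) * Y ^ (ms ! 2 - 1))
      - qconst (f ms) * (X ^ (ms ! 0 - 1) * (Z - Y) ^ (ms ! 1 - 1) * Z ^ (ms ! 2 - 1)))"
    if ms: "ms \<in> Sset N 3" for ms
  proof -
    obtain a b c where abc: "ms = [a, b, c]" "odd a" "odd b" "3 \<le> a" using ms by (elim Sset3_E)
    obtain i j k where ijk: "ns = [i, j, k]" "odd i" "3 \<le> i" using assms by (elim Sset3_E)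
    have "even (b - 1)" using abc by simp
    have "(if take 1 ms = take 1 ns then 1 else 0) * ecoef (drop 1 ms) (drop 1 ns)
        = (if a - 1 = i - 1 then Poly_Mapping.lookup (ihara (b - 1) [c - 1]) (expvec [j - 1, k - 1]) else 0)"
      using abc ijk by (auto simp: ecoef_def)
    also have "\<dots> = coeff_at ns (X ^ (a - 1) * qsubst (\<lambda>i. qvar (Suc i)) (ihara (b - 1) [c - 1]))"
      unfolding coeff_at_def ijk list.map lookup_mult_qvar0_shift ..
    also have "qsubst (\<lambda>i. qvar (Suc i)) (ihara (b - 1) [c - 1])
        = Y ^ (b - 1) * Z ^ (c - 1) + (Z - Y) ^ (b - 1) * Y ^ (c - 1) - (Z - Y) ^ (b - 1) * Z ^ (c - 1)"
      using \<open>even (b - 1)\<close> by (simp add: ihara_even_2 qsubst_hom numeral_2_eq_2)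
    finally show ?thesis
      by (simp add: abc(1) coeff_at_linear coeff_at_qconst_mult ring_distribs mult.assoc)
  qed
  then show ?thesis
    unfolding E2_row_def form3_def sum.distrib[symmetric] sum_subtractf[symmetric] coeff_at_sum
    by (rule sum.cong[OF refl])
qed

section \<open>Translation to vectors and matrices\<close>

definition vec3 :: "nat \<Rightarrow> (nat list \<Rightarrow> rat) \<Rightarrow> rat vec" where
  "vec3 N f = vec (sdim N 3) (\<lambda>p. f (Slist N 3 ! p))"

lemma vec3_carrier [simp]: "vec3 N f \<in> carrier_vec (sdim N 3)" "dim_vec (vec3 N f) = sdim N 3"
  by (simp_all add: vec3_def)

lemma vec3_cong: "(\<And>ns. ns \<in> Sset N 3 \<Longrightarrow> f ns = g ns) \<Longrightarrow> vec3 N f = vec3 N g"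
  by (auto simp: vec3_def Slist_nth_mem)

lemma vec3_eq_0D:
  assumes "vec3 N f = 0\<^sub>v (sdim N 3)" "ns \<in> Sset N 3"
  shows "f ns = 0"
proof -
  obtain p where p: "p < sdim N 3" "ns = Slist N 3 ! p"
    using assms(2) unfolding sdim_def by (metis in_set_conv_nth set_Slist)
  then have "f ns = vec3 N f $ p" by (simp add: vec3_def)
  then show ?thesis using assms(1) p(1) by simp
qed

lemma Emat_carrier [simp]: "Emat N r \<in> carrier_mat (sdim N r) (sdim N r)"
  and Ej_carrier [simp]: "Ej N r j \<in> carrier_mat (sdim N r) (sdim N r)"
  by (simp_all add: Emat_def Ej_def)

lemma transpose_Emat_mult: "transpose_mat (Emat N 3) *\<^sub>v vec3 N f = vec3 N (E_row N f)"
proof (rule eq_vecI)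
  fix q assume "q < dim_vec (vec3 N (E_row N f))"
  then have q: "q < sdim N 3" by simp
  have "(transpose_mat (Emat N 3) *\<^sub>v vec3 N f) $ q
      = (\<Sum>p<sdim N 3. ecoef (Slist N 3 ! p) (Slist N 3 ! q) * f (Slist N 3 ! p))"
    using q by (simp add: Emat_def vec3_def scalar_prod_def lessThan_atLeast0)
  also have "\<dots> = (\<Sum>ms\<in>Sset N 3. ecoef ms (Slist N 3 ! q) * f ms)"
    by (rule sum_Slist)
  finally show "(transpose_mat (Emat N 3) *\<^sub>v vec3 N f) $ q = vec3 N (E_row N f) $ q"
    using q by (simp add: vec3_def E_row_def mult.commute)
qed (simp add: Emat_def)

lemma transpose_Ej_mult: "transpose_mat (Ej N 3 2) *\<^sub>v vec3 N f = vec3 N (E2_row N f)"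
proof (rule eq_vecI)
  fix q assume "q < dim_vec (vec3 N (E2_row N f))"
  then have q: "q < sdim N 3" by simp
  let ?e = "\<lambda>ms ns. (if take 1 ms = take 1 ns then 1 else 0) * ecoef (drop 1 ms) (drop 1 ns)"
  have "(transpose_mat (Ej N 3 2) *\<^sub>v vec3 N f) $ q
      = (\<Sum>p<sdim N 3. ?e (Slist N 3 ! p) (Slist N 3 ! q) * f (Slist N 3 ! p))"
    using q by (simp add: Ej_def Let_def vec3_def scalar_prod_def lessThan_atLeast0)
  also have "\<dots> = (\<Sum>ms\<in>Sset N 3. ?e ms (Slist N 3 ! q) * f ms)"
    by (rule sum_Slist[where h = "\<lambda>ms. ?e ms (Slist N 3 ! q) * f ms"])
  finally show "(transpose_mat (Ej N 3 2) *\<^sub>v vec3 N f) $ q = vec3 N (E2_row N f) $ q"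
    using q by (simp add: vec3_def E2_row_def mult.commute)
qed (simp add: Ej_def)

lemma Cmat_3: "Cmat N 3 = Ej N 3 2 * Emat N 3"
proof -
  have "[2..<3] = [2 :: nat]" by (simp add: upt_rec)
  then show ?thesis by (simp add: Cmat_def)
qed

text \<open>A row vector meets the factor \<open>E2\<close> first and \<open>E\<close> second; rows
  are encoded as columns, whence the transposes.\<close>

lemma transpose_Cmat_mult:
  "transpose_mat (Cmat N 3) *\<^sub>v vec3 N f = vec3 N (E_row N (E2_row N f))"
proof -
  have "transpose_mat (Cmat N 3) = transpose_mat (Emat N 3) * transpose_mat (Ej N 3 2)"
    unfolding Cmat_3 by (rule transpose_mult[OF Ej_carrier Emat_carrier])
  also have "\<dots> *\<^sub>v vec3 N f = transpose_mat (Emat N 3) *\<^sub>v (transpose_mat (Ej N 3 2) *\<^sub>v vec3 N f)"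
    by (rule assoc_mult_mat_vec[of _ "sdim N 3" "sdim N 3" _ "sdim N 3"]) simp_all
  finally show ?thesis by (simp add: transpose_Emat_mult transpose_Ej_mult)
qed

lemma transpose_Fmat_mult:
  "transpose_mat (Fmat N 3) *\<^sub>v vec3 N f = vec3 N (\<lambda>ns. E_row N f ns - f ns)"
proof -
  have "transpose_mat (Fmat N 3) = transpose_mat (Emat N 3) - 1\<^sub>m (sdim N 3)"
    unfolding Fmat_def by (rule eq_matI) (auto simp: Emat_def)
  also have "\<dots> *\<^sub>v vec3 N f = transpose_mat (Emat N 3) *\<^sub>v vec3 N f - 1\<^sub>m (sdim N 3) *\<^sub>v vec3 N f"
    by (rule minus_mult_distrib_mat_vec[of _ "sdim N 3" "sdim N 3"]) simp_all
  also have "\<dots> = vec3 N (\<lambda>ns. E_row N f ns - f ns)"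
    unfolding transpose_Emat_mult by (rule eq_vecI) (simp_all add: vec3_def)
  finally show ?thesis .
qed

lemma poly_of_vec3: "poly_of N 3 (vec3 N f) [a, b, c] = form3 N f a b c"
proof -
  have "poly_of N 3 (vec3 N f) [a, b, c] = (\<Sum>p<sdim N 3. qconst (f (Slist N 3 ! p))
      * mono_at [a, b, c] (map (\<lambda>k. k - 1) (Slist N 3 ! p)))"
    unfolding poly_of_def by (intro sum.cong refl) (simp add: vec3_def)
  also have "\<dots> = (\<Sum>ns\<in>Sset N 3. qconst (f ns) * mono_at [a, b, c] (map (\<lambda>k. k - 1) ns))"
    by (rule sum_Slist[where h = "\<lambda>ns. qconst (f ns) * mono_at [a, b, c] (map (\<lambda>k. k - 1) ns)"])
  also have "\<dots> = form3 N f a b c"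
    unfolding form3_def by (intro sum.cong refl) (auto elim!: Sset3_E simp: mult.assoc)
  finally show ?thesis .
qed

text \<open>Even period polynomials in the first two variables. The relations are stated for all
  arguments, so that they apply after any substitution.\<close>

definition period3 :: "nat \<Rightarrow> (nat list \<Rightarrow> rat) \<Rightarrow> bool" where
  "period3 N f \<longleftrightarrow> (\<forall>a b c. form3 N f b a c = - form3 N f a b c) \<and>
     (\<forall>a b c. form3 N f a b c + form3 N f b (b - a) c + form3 N f (b - a) a c = 0)"

text \<open>Antisymmetry turns the three-term relation into the defining equation of
  \<open>Wvec\<close>.\<close>

lemma period3_in_Wvec:
  assumes "period3 N f"
  shows "vec3 N f \<in> Wvec N 3"
proof -
  have upt: "[0..<3] = [0, 1, 2 :: nat]" "[2..<3] = [2 :: nat]" by (auto simp: upt_rec numeral_3_eq_3)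
  have "form3 N f X Y Z + form3 N f Y (Y - X) Z + form3 N f (Y - X) X Z = 0"
    "form3 N f Y (Y - X) Z = - form3 N f (Y - X) Y Z"
    using assms unfolding period3_def by blast+
  note rels = this
  have "form3 N f X Y Z = (form3 N f X Y Z + form3 N f Y (Y - X) Z + form3 N f (Y - X) X Z)
      - form3 N f Y (Y - X) Z - form3 N f (Y - X) X Z" by simp
  also have "\<dots> = form3 N f (Y - X) Y Z - form3 N f (Y - X) X Z"
    unfolding rels(1) unfolding rels(2) by simp
  finally show ?thesis by (simp add: Wvec_def poly_of_vec3 upt)
qed

text \<open>Swapping the first two arguments turns the two surviving terms of the action of \<open>E\<close> into
  those of \<open>E2\<close>.\<close>
lemma period3_F_row:
  assumes "period3 N f" "ns \<in> Sset N 3"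
  shows "E_row N f ns - f ns = - E2_row N f ns"
proof -
  have three: "form3 N f X Y Z + form3 N f Y (Y - X) Z + form3 N f (Y - X) X Z = 0"
    and "form3 N f b a c = - form3 N f a b c" for a b c
    using assms unfolding period3_def by blast+
  then have anti: "coeff_at ns (form3 N f b a c) = - coeff_at ns (form3 N f a b c)" for a b c
    by (metis coeff_at_linear(3))
  have "coeff_at ns (form3 N f X Y Z) + coeff_at ns (form3 N f Y (Y - X) Z)
      + coeff_at ns (form3 N f (Y - X) X Z) = 0"
    using arg_cong[OF three, of "coeff_at ns"] by (simp only: coeff_at_linear)
  then show ?thesis
    using coeff_at_form3_vars[OF assms(2), of f] anti[of Y "Y - X" Z]
      anti[of X "Z - Y" Y] anti[of X "Z - Y" Z]
    unfolding E_row_eq E2_row_eq[OF assms(2)] coeff_at_linear by linarith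
qed

section \<open>The left kernel of the product\<close>

text \<open>Twice the projection of \<open>P(a,b,c) + P(a,c-b,b) - P(a,c-b,c)\<close> onto the monomials with even
  positive exponents: the odd part is removed by averaging over \<open>b \<mapsto> -b\<close>, and the values
  at \<open>b = 0\<close> and \<open>c = 0\<close> are subtracted.\<close>
definition E2_form :: "nat \<Rightarrow> (nat list \<Rightarrow> rat) \<Rightarrow> qpoly \<Rightarrow> qpoly \<Rightarrow> qpoly \<Rightarrow> qpoly" where
  "E2_form N f a b c = form3 N f a b c + form3 N f a b c
     + form3 N f a (c - b) b + form3 N f a (c + b) b - form3 N f a (c - b) c - form3 N f a (c + b) c
     + form3 N f a c c + form3 N f a c c - form3 N f a b b - form3 N f a b b"

lemma E2_form_neg:
  "E2_form N f (- a) b c = E2_form N f a b c"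
  "E2_form N f a (- b) c = E2_form N f a b c"
  "E2_form N f a b (- c) = E2_form N f a b c"
proof -
  have "form3 N f a (- c - b) d = form3 N f a (c + b) d" for d
    using form3_neg(2)[of N f a "c + b" d] by simp
  moreover have "form3 N f a (- c + b) d = form3 N f a (c - b) d" for d
    using form3_neg(2)[of N f a "c - b" d] by simp
  ultimately show "E2_form N f a b (- c) = E2_form N f a b c"
    by (simp add: E2_form_def)
qed (simp_all add: E2_form_def)

lemma E2_form_0: "E2_form N f 0 b c = 0" "E2_form N f a 0 c = 0" "E2_form N f a b 0 = 0"
  by (simp_all add: E2_form_def)

lemma E2_form_scale:
  "E2_form N f (qconst t * a) (qconst t * b) (qconst t * c) = qconst (t ^ (N - 3)) * E2_form N f a b c"
  unfolding E2_form_def distrib_left[symmetric] right_diff_distrib[symmetric] form3_scale ..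

lemma qsubst_E2_form:
  "qsubst \<sigma> (E2_form N f a b c) = E2_form N f (qsubst \<sigma> a) (qsubst \<sigma> b) (qsubst \<sigma> c)"
  by (simp only: E2_form_def qsubst_form3 qsubst_hom)

lemma coeff_at_form3_flip:
  assumes "ns \<in> Sset N 3" "\<sigma> = (\<lambda>j. if j = i then - qvar j else qvar j)"
  shows "coeff_at ns (form3 N f a b c) = coeff_at ns (form3 N f (qsubst \<sigma> a) (qsubst \<sigma> b) (qsubst \<sigma> c))"
  unfolding qsubst_form3[symmetric] assms(2) coeff_at_flip[OF assms(1)] ..

lemma coeff_at_form3_eq_0:
  assumes "ns \<in> Sset N 3" "i < 3" "qsubst (qvar(i := 0)) a = a" "qsubst (qvar(i := 0)) b = b"
    "qsubst (qvar(i := 0)) c = c"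
  shows "coeff_at ns (form3 N f a b c) = 0"
  using assms by (intro coeff_at_eq_0[of _ N i]) (simp_all add: qsubst_form3)

text \<open>Flipping the sign of \<open>Y\<close> identifies the terms in \<open>Z + Y\<close> with
  those in \<open>Z - Y\<close>, and the subtracted boundary terms lack a variable, so they
  contribute nothing.\<close>

lemma two_E2_row:
  assumes "ns \<in> Sset N 3"
  shows "coeff_at ns (E2_form N f X Y Z) = 2 * E2_row N f ns"
proof -
  have "coeff_at ns (form3 N f X (Z + Y) d) = coeff_at ns (form3 N f X (Z - Y) d)"
    if "d = Y \<or> d = Z" for d
    using coeff_at_form3_flip[OF assms refl, of f X "Z + Y" d 1] that
    by (auto simp: qsubst_hom)
  moreover have "coeff_at ns (form3 N f X Z Z) = 0"
    by (rule coeff_at_form3_eq_0[OF assms, of 1]) simp_all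
  moreover have "coeff_at ns (form3 N f X Y Y) = 0"
    by (rule coeff_at_form3_eq_0[OF assms, of 2]) simp_all
  ultimately show ?thesis
    unfolding E2_row_eq[OF assms] E2_form_def coeff_at_linear by simp
qed

lemma form3_cong:
  "(\<And>ns. ns \<in> Sset N 3 \<Longrightarrow> f ns = g ns) \<Longrightarrow> form3 N f a b c = form3 N g a b c"
  unfolding form3_def by (intro sum.cong) auto

text \<open>Lifts \<open>two_E2_row\<close> from coefficients to polynomials: \<open>E2_form\<close>
  has the symmetries required by \<open>eq_form3I\<close>. The result can be evaluated at any
  arguments, as applying \<open>E\<close> next requires.\<close>

lemma form3_two_E2_row:
  assumes "9 \<le> N"
  shows "form3 N (\<lambda>ns. 2 * E2_row N f ns) a b c = E2_form N f a b c"
proof -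
  have three: "i = 0 \<or> i = 1 \<or> i = 2" if "i < 3" for i :: nat using that by auto
  have "E2_form N f X Y Z = form3 N (\<lambda>ns. coeff_at ns (E2_form N f X Y Z)) X Y Z"
  proof (rule eq_form3I)
    fix i :: nat assume "i < 3"
    then show "qsubst (\<lambda>j. if j = i then - qvar j else qvar j) (E2_form N f X Y Z) = E2_form N f X Y Z"
      and "qsubst (qvar(i := 0)) (E2_form N f X Y Z) = 0"
      using three[of i] by (auto simp: qsubst_E2_form E2_form_neg E2_form_0)
  next
    fix i :: nat assume "3 \<le> i"
    then show "qsubst (qvar(i := 0)) (E2_form N f X Y Z) = E2_form N f X Y Z"
      by (simp add: qsubst_E2_form)
  next
    show "qsubst (\<lambda>j. qconst 2 * qvar j) (E2_form N f X Y Z) = qconst (2 ^ (N - 3)) * E2_form N f X Y Z"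
      by (simp only: qsubst_E2_form qsubst_qvar E2_form_scale)
  qed (rule assms)
  also have "\<dots> = form3 N (\<lambda>ns. 2 * E2_row N f ns) X Y Z"
    by (rule form3_cong) (rule two_E2_row)
  finally have "qsubst (\<lambda>i. if i = 0 then a else if i = 1 then b else c) (E2_form N f X Y Z)
    = qsubst (\<lambda>i. if i = 0 then a else if i = 1 then b else c) (form3 N (\<lambda>ns. 2 * E2_row N f ns) X Y Z)"
    by simp
  then show ?thesis by (simp add: qsubst_form3 qsubst_E2_form)
qed

text \<open>Applying \<open>E\<close> gives five copies of \<open>E2_form\<close>. Most terms cancel
  by antisymmetry, and the rest form three instances of the three-term relation.\<close>

lemma period3_E_E2_row:
  assumes f: "period3 N f" and ns: "ns \<in> Sset N 3"
  shows "E_row N (E2_row N f) ns = 0"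
proof -
  define P where "P a b c = coeff_at ns (form3 N f a b c)" for a b c
  have "9 \<le> N" using ns by (auto elim!: Sset3_E)
  have anti: "P b a c = - P a b c" for a b c
    using f unfolding period3_def P_def by (metis coeff_at_linear(3))
  have three: "P a b c + P b (b - a) c + P (b - a) a c = 0" for a b c
  proof -
    have "form3 N f a b c + form3 N f b (b - a) c + form3 N f (b - a) a c = 0"
      using f unfolding period3_def by blast
    from arg_cong[OF this, of "coeff_at ns"] show ?thesis by (simp only: coeff_at_linear P_def)
  qed
  have comm: "P (a - b) c d = P (b - a) c d" "P c (a - b) d = P c (b - a) d" for a b c d
    unfolding P_def by (metis form3_diff_commute(1), metis form3_diff_commute(2))
  have neg: "P (- a) b c = P a b c" "P a (- b) c = P a b c" "P a b (- c) = P a b c" for a b c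
    by (simp_all add: P_def)
  note flip = coeff_at_form3_flip[OF ns refl, of f, folded P_def]
  \<comment> \<open>The flipped variable is absent from the first argument, so it changes the sum in
    the second; a sign in the third is invisible.\<close>
  have flips:
    "P X (Z + Y) Y = P X (Z - Y) Y" "P X (Z + Y) Z = P X (Z - Y) Z"
    "P (Y - X) (Z + X) X = P (Y - X) (Z - X) X" "P (Y - X) (Z + X) Z = P (Y - X) (Z - X) Z"
    "P (Y - X) (Z + Y) Y = P (Y - X) (Z - Y) Y" "P (Y - X) (Z + Y) Z = P (Y - X) (Z - Y) Z"
    "P (Z - Y) (Y + X) X = P (Z - Y) (Y - X) X" "P (Z - Y) (Y + X) Y = P (Z - Y) (Y - X) Y"
    "P (Z - Y) (Z + X) X = P (Z - Y) (Z - X) X" "P (Z - Y) (Z + X) Z = P (Z - Y) (Z - X) Z"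
    using flip[of X "Z + Y" Y 1] flip[of X "Z + Y" Z 1]
      flip[of "Y - X" "Z + X" X 2] flip[of "Y - X" "Z + X" Z 2]
      flip[of "Y - X" "Z + Y" Y 2] flip[of "Y - X" "Z + Y" Z 2]
      flip[of "Z - Y" "Y + X" X 0] flip[of "Z - Y" "Y + X" Y 0]
      flip[of "Z - Y" "Z + X" X 0] flip[of "Z - Y" "Z + X" Z 0]
    by (simp_all add: qsubst_hom neg comm(2)[of _ X Z] comm(2)[of _ Y Z])
  note zero = coeff_at_form3_eq_0[OF ns, of _ _ _ _ f, folded P_def]
  have zeros: "P X Z Z = 0" "P X Y Y = 0" "P (Y - X) X X = 0" "P (Y - X) Y Y = 0"
    "P (Z - Y) Y Y = 0" "P (Z - Y) Z Z = 0"
    using zero[of 1 X Z Z] zero[of 2 X Y Y] zero[of 2 "Y - X" X X] zero[of 2 "Y - X" Y Y]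
      zero[of 0 "Z - Y" Y Y] zero[of 0 "Z - Y" Z Z]
    by (simp_all add: qsubst_hom)
  have "2 * E_row N (E2_row N f) ns = E_row N (\<lambda>ns. 2 * E2_row N f ns) ns"
    by (simp add: E_row_def sum_distrib_left mult.assoc)
  also have "\<dots> = coeff_at ns (E2_form N f X Y Z + E2_form N f (Y - X) X Z
      - E2_form N f (Y - X) Y Z + E2_form N f (Z - Y) X Y - E2_form N f (Z - Y) X Z)"
    unfolding E_row_eq form3_two_E2_row[OF \<open>9 \<le> N\<close>] ..
  \<comment> \<open>Mixed terms cancel in pairs, such as \<open>P X (Z - Y) Y\<close> against
    \<open>P (Z - Y) X Y\<close>, while \<open>P (Y - X) Z Z\<close> and
    \<open>P (Z - Y) X X\<close> occur with both signs.\<close>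
  also have "\<dots> = 2 * (P X Y Z + P (Y - X) X Z - P (Y - X) Y Z)
      + 2 * (P (Y - X) (Z - X) X + P (Z - Y) (Y - X) X - P (Z - Y) (Z - X) X)
      - 2 * (P (Y - X) (Z - X) Z + P (Z - Y) (Y - X) Z - P (Z - Y) (Z - X) Z)"
    unfolding E2_form_def coeff_at_linear P_def[symmetric]
    using flips zeros anti[of X "Z - Y" Y] anti[of X "Z - Y" Z] anti[of "Z - Y" "Y - X" Y]
      anti[of "Z - Y" "Y - X" Z] comm(2)[of _ X Y] comm(2)[of _ X Z] comm(2)[of _ Y Z]
    by (simp add: algebra_simps)
  \<comment> \<open>Each bracket is a three-term relation; in the last two it is taken at
    \<open>Y - X\<close> and \<open>Z - X\<close>, whose difference is \<open>Z - Y\<close>.\<close>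
  also have "\<dots> = 0"
    using three[of X Y Z] three[of "Y - X" "Z - X" X] three[of "Y - X" "Z - X" Z]
      anti[of "Y - X" Y Z] anti[of "Z - Y" "Z - X" X] anti[of "Z - Y" "Z - X" Z]
    by simp
  finally show ?thesis by simp
qed

section \<open>Counting period polynomials\<close>

text \<open>Carries an identity of univariate polynomials back to forms of degree \<open>k\<close>;
  coefficients beyond \<open>k\<close> are dropped.\<close>

definition homogenize :: "nat \<Rightarrow> rat poly \<Rightarrow> qpoly \<Rightarrow> qpoly \<Rightarrow> qpoly" where
  "homogenize k p a b = (\<Sum>i\<le>k. qconst (Polynomial.coeff p i) * (a ^ i * b ^ (k - i)))"

lemma homogenize_0 [simp]: "homogenize k 0 a b = 0"
  by (simp add: homogenize_def)

lemma homogenize_add: "homogenize k (p + q) a b = homogenize k p a b + homogenize k q a b"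
  by (simp add: homogenize_def single_add distrib_right sum.distrib)

lemma homogenize_smult: "homogenize k (Polynomial.smult t p) a b = qconst t * homogenize k p a b"
proof -
  have "qconst (t * x) = qconst t * qconst x" for x by (simp add: mult_single)
  then show ?thesis by (simp add: homogenize_def sum_distrib_left mult.assoc)
qed

lemma homogenize_sum: "homogenize k (\<Sum>x\<in>A. p x) a b = (\<Sum>x\<in>A. homogenize k (p x) a b)"
  by (induction A rule: infinite_finite_induct) (simp_all add: homogenize_add)

lemma homogenize_pCons_0: "homogenize (Suc k) (pCons 0 p) a b = a * homogenize k p a b"
  unfolding homogenize_def sum_distrib_left
  by (subst sum.atMost_Suc_shift) (simp add: mult.left_commute mult.assoc)

lemma homogenize_Suc:
  assumes "Polynomial.degree p \<le> k"
  shows "homogenize (Suc k) p a b = b * homogenize k p a b"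
proof -
  have "Polynomial.coeff p (Suc k) = 0" using assms by (simp add: coeff_eq_0)
  then have "homogenize (Suc k) p a b = (\<Sum>i\<le>k. qconst (Polynomial.coeff p i) * (a ^ i * b ^ (Suc k - i)))"
    by (simp add: homogenize_def)
  also have "\<dots> = (\<Sum>i\<le>k. b * (qconst (Polynomial.coeff p i) * (a ^ i * b ^ (k - i))))"
    by (intro sum.cong refl) (simp add: Suc_diff_le mult.left_commute)
  finally show ?thesis by (simp add: homogenize_def sum_distrib_left)
qed

text \<open>The polynomial \<open>1 - t\<close> is the dehomogenised form of
  \<open>b - a\<close>.\<close>

lemma homogenize_one_minus:
  assumes "Polynomial.degree p \<le> k"
  shows "homogenize (Suc k) ([:1, -1:] * p) a b = (b - a) * homogenize k p a b"
proof -
  have "[:1, -1:] * p = p + Polynomial.smult (-1) (pCons 0 p)" by simp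
  then have "homogenize (Suc k) ([:1, -1:] * p) a b = homogenize (Suc k) p a b
      + qconst (-1) * homogenize (Suc k) (pCons 0 p) a b"
    by (simp only: homogenize_add homogenize_smult)
  also have "\<dots> = (b - a) * homogenize k p a b"
    by (simp add: homogenize_Suc[OF assms] homogenize_pCons_0 single_uminus left_diff_distrib)
  finally show ?thesis .
qed

lemma degree_power_X: "Polynomial.degree ([:0, 1 :: rat:] ^ n) = n"
  and degree_power_one_minus: "Polynomial.degree ([:1, -1 :: rat:] ^ n) = n"
  by (simp_all add: degree_power_eq)

lemma homogenize_power_X: "homogenize (n + j) ([:0, 1:] ^ n) a b = a ^ n * b ^ j"
proof (induction j)
  case 0
  have "homogenize n ([:0, 1:] ^ n) a b = a ^ n"
  proof (induction n)
    case 0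
    then show ?case by (simp add: homogenize_def)
  next
    case (Suc n)
    have "[:0, 1 :: rat:] ^ Suc n = pCons 0 ([:0, 1:] ^ n)" by simp
    then show ?case by (simp only: homogenize_pCons_0 Suc power_Suc)
  qed
  then show ?case by simp
next
  case (Suc j)
  then show ?case
    using homogenize_Suc[of "[:0, 1:] ^ n" "n + j" a b]
    by (simp add: degree_power_X mult.left_commute)
qed

lemma homogenize_power_mult:
  "homogenize (m + n) ([:1, -1:] ^ m * [:0, 1:] ^ n) a b = (b - a) ^ m * a ^ n"
proof (induction m)
  case 0
  then show ?case using homogenize_power_X[of n 0 a b] by simp
next
  case (Suc m)
  have "Polynomial.degree ([:1, -1 :: rat:] ^ m * [:0, 1:] ^ n) \<le> m + n"
    by (rule order.trans[OF degree_mult_le]) (simp add: degree_power_X degree_power_one_minus)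
  from homogenize_one_minus[OF this, of a b] Suc show ?case
    by (simp only: power_Suc mult.assoc add_Suc)
qed

lemma homogenize_power_one_minus:
  "homogenize (i + j) ([:1, -1:] ^ j) a b = b ^ i * (b - a) ^ j"
proof (induction i)
  case 0
  then show ?case using homogenize_power_mult[of j 0 a b] by simp
next
  case (Suc i)
  then show ?case
    using homogenize_Suc[of "[:1, -1:] ^ j" "i + j" a b]
    by (simp add: degree_power_one_minus mult.assoc)
qed

lemma homogenize_three_term:
  "homogenize (i + j) (three_term i j) a b = a ^ i * b ^ j + b ^ i * (b - a) ^ j + (b - a) ^ i * a ^ j"
  unfolding three_term_def homogenize_add homogenize_power_X homogenize_power_one_minus
    homogenize_power_mult ..

section \<open>The period condition for a fixed third entry\<close>

definition slice :: "nat \<Rightarrow> (nat list \<Rightarrow> rat) \<Rightarrow> nat \<Rightarrow> rat poly" where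
  "slice N f c = (\<Sum>ns\<in>{ns \<in> Sset N 3. ns ! 2 = c}.
     Polynomial.smult (f ns) (three_term (ns ! 0 - 1) (ns ! 1 - 1)))"

text \<open>Includes values of \<open>c\<close> too large to be the third entry of an index; for
  these the slice is an empty sum and \<open>cusp_dim (N - c)\<close> is 0.\<close>

definition third_entries :: "nat \<Rightarrow> nat set" where
  "third_entries N = {c. 3 \<le> c \<and> c \<le> N \<and> odd c \<and> even (N - c)}"

text \<open>The slice is the dehomogenised three-term expression of the part with third exponent
  \<open>c - 1\<close>, a binary form of degree \<open>N - c - 2\<close>, so
  \<open>three_term_sum_eq_0\<close> applies.\<close>

lemma slice_eq_0:
  assumes c: "c \<in> third_entries N"
    and anti: "\<And>ns. ns \<in> Sset N 3 \<Longrightarrow> f [ns ! 1, ns ! 0, ns ! 2] = - f ns"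
    and coeffs: "\<And>j. j < (N - c - 2) div 6 \<Longrightarrow> Polynomial.coeff (slice N f c) (2 * j + 1) = 0"
  shows "slice N f c = 0"
proof -
  define k where "k = N - c - 2"
  \<comment> \<open>Entries exceed exponents by 1. Exponents that belong to no index, such as 0 and
    the odd ones, get coefficient 0.\<close>
  define \<alpha> where "\<alpha> i = (if [i + 1, k - i + 1, c] \<in> Sset N 3 then f [i + 1, k - i + 1, c] else 0)" for i
  have slice: "slice N f c = (\<Sum>i\<le>k. Polynomial.smult (\<alpha> i) (three_term i (k - i)))"
  proof -
    have "(\<Sum>i\<le>k. Polynomial.smult (\<alpha> i) (three_term i (k - i)))
        = (\<Sum>i\<in>{i. i \<le> k \<and> [i + 1, k - i + 1, c] \<in> Sset N 3}.
            Polynomial.smult (f [i + 1, k - i + 1, c]) (three_term i (k - i)))"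
      by (intro sum.mono_neutral_cong_right) (auto simp: \<alpha>_def)
    also have "\<dots> = slice N f c"
      unfolding slice_def
      by (rule sum.reindex_bij_witness[of _ "\<lambda>ns. ns ! 0 - 1" "\<lambda>i. [i + 1, k - i + 1, c]"])
        (auto elim!: Sset3_E simp: k_def)
    finally show ?thesis ..
  qed
  show ?thesis
  proof (rule three_term_sum_eq_0[OF _ _ _ slice])
    show "even k" using c by (auto simp: k_def third_entries_def)
    show "\<alpha> i = 0" if "odd i" for i using that by (simp add: \<alpha>_def)
    show "\<alpha> (k - i) = - \<alpha> i" if "i \<le> k" for i
      using that anti[of "[i + 1, k - i + 1, c]"] by (auto simp: \<alpha>_def add.commute)
    show "Polynomial.coeff (slice N f c) (2 * j + 1) = 0" if "j < k div 6" for j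
      using that coeffs by (simp add: k_def)
  qed
qed

lemma Sset3_third: "ns \<in> Sset N 3 \<Longrightarrow> ns ! 2 \<in> third_entries N"
  by (elim Sset3_E) (auto simp: third_entries_def)

text \<open>Sorted by the third entry, the three-term sum becomes a sum of homogenised slices times
  powers of \<open>c\<close>.\<close>

lemma period3I:
  assumes anti: "\<And>ns. ns \<in> Sset N 3 \<Longrightarrow> f [ns ! 1, ns ! 0, ns ! 2] = - f ns"
    and coeffs: "\<And>c j. c \<in> third_entries N \<Longrightarrow> j < (N - c - 2) div 6 \<Longrightarrow>
      Polynomial.coeff (slice N f c) (2 * j + 1) = 0"
  shows "period3 N f"
  unfolding period3_def
proof (intro conjI allI)
  fix a b c
  have "form3 N f b a c = (\<Sum>ns\<in>Sset N 3. qconst (f [ns ! 1, ns ! 0, ns ! 2]) *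
     (a ^ (ns ! 0 - 1) * b ^ (ns ! 1 - 1) * c ^ (ns ! 2 - 1)))"
    unfolding form3_def
    by (rule sum.reindex_bij_witness[of _ "\<lambda>ns. [ns ! 1, ns ! 0, ns ! 2]" "\<lambda>ns. [ns ! 1, ns ! 0, ns ! 2]"])
      (auto elim!: Sset3_E simp: mult_ac)
  also have "\<dots> = (\<Sum>ns\<in>Sset N 3. - (qconst (f ns) *
     (a ^ (ns ! 0 - 1) * b ^ (ns ! 1 - 1) * c ^ (ns ! 2 - 1))))"
    by (intro sum.cong refl) (simp only: anti single_uminus mult_minus_left)
  finally show "form3 N f b a c = - form3 N f a b c"
    by (simp add: form3_def sum_negf)
next
  fix a b c
  let ?h = "\<lambda>ns. qconst (f ns) * homogenize (N - ns ! 2 - 2) (three_term (ns ! 0 - 1) (ns ! 1 - 1)) a b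
    * c ^ (ns ! 2 - 1)"
  have "form3 N f a b c + form3 N f b (b - a) c + form3 N f (b - a) a c = (\<Sum>ns\<in>Sset N 3. ?h ns)"
    unfolding form3_def sum.distrib[symmetric]
  proof (intro sum.cong refl)
    fix ns assume "ns \<in> Sset N 3"
    then obtain i j l where *: "ns = [i, j, l]" "3 \<le> i" "3 \<le> j" "i + j + l = N" by (elim Sset3_E)
    then have "N - l - 2 = (i - 1) + (j - 1)" by simp
    then show "qconst (f ns) * (a ^ (ns ! 0 - 1) * b ^ (ns ! 1 - 1) * c ^ (ns ! 2 - 1))
      + qconst (f ns) * (b ^ (ns ! 0 - 1) * (b - a) ^ (ns ! 1 - 1) * c ^ (ns ! 2 - 1))
      + qconst (f ns) * ((b - a) ^ (ns ! 0 - 1) * a ^ (ns ! 1 - 1) * c ^ (ns ! 2 - 1)) = ?h ns"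
      using homogenize_three_term[of "i - 1" "j - 1" a b]
      by (simp add: *(1) ring_distribs mult.assoc)
  qed
  also have "\<dots> = (\<Sum>l\<in>(\<lambda>ns. ns ! 2) ` Sset N 3. \<Sum>ns\<in>{ns \<in> Sset N 3. ns ! 2 = l}. ?h ns)"
    by (rule sum.image_gen) simp
  also have "\<dots> = 0"
  proof (rule sum.neutral, safe)
    fix ns assume "ns \<in> Sset N 3"
    then have l: "ns ! 2 \<in> third_entries N" by (rule Sset3_third)
    let ?l = "ns ! 2"
    have "(\<Sum>ns\<in>{ns \<in> Sset N 3. ns ! 2 = ?l}. ?h ns)
        = homogenize (N - ?l - 2) (slice N f ?l) a b * c ^ (?l - 1)"
      unfolding slice_def homogenize_sum homogenize_smult sum_distrib_right
      by (intro sum.cong refl) auto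
    also have "slice N f ?l = 0"
      by (rule slice_eq_0[OF l anti coeffs[OF l]])
    finally show "(\<Sum>ns\<in>{ns \<in> Sset N 3. ns ! 2 = ?l}. ?h ns) = 0" by simp
  qed
  finally show "form3 N f a b c + form3 N f b (b - a) c + form3 N f (b - a) a c = 0" .
qed

section \<open>Period polynomials in the last two variables\<close>

lemma form3_rotate:
  "form3 N (\<lambda>ns. g [ns ! 1, ns ! 2, ns ! 0]) a b c = form3 N g b c a"
  unfolding form3_def
  by (rule sum.reindex_bij_witness[of _ "\<lambda>ns. [ns ! 2, ns ! 0, ns ! 1]" "\<lambda>ns. [ns ! 1, ns ! 2, ns ! 0]"])
    (auto elim!: Sset3_E simp: mult_ac)

text \<open>After the rotation the three terms of \<open>E2\<close> are, up to antisymmetry, those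
  of the three-term relation at \<open>Y\<close> and \<open>Z\<close>.\<close>

lemma period3_E2_row_rotate:
  assumes "period3 N g" "ns \<in> Sset N 3"
  shows "E2_row N (\<lambda>ns. g [ns ! 1, ns ! 2, ns ! 0]) ns = 0"
proof -
  have three: "form3 N g Y Z X + form3 N g Z (Z - Y) X + form3 N g (Z - Y) Y X = 0"
    and "form3 N g Z (Z - Y) X = - form3 N g (Z - Y) Z X"
    using assms(1) unfolding period3_def by blast+
  then have "coeff_at ns (form3 N g Z (Z - Y) X) = - coeff_at ns (form3 N g (Z - Y) Z X)"
    by (simp only: coeff_at_linear)
  then show ?thesis
    using arg_cong[OF three, of "coeff_at ns"]
    unfolding E2_row_eq[OF assms(2)] form3_rotate coeff_at_linear by linarith
qed

section \<open>The equations for period polynomials and their number\<close>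

definition period_eqs :: "nat \<Rightarrow> (nat list + (nat \<times> nat)) set" where
  "period_eqs N = {ns \<in> Sset N 3. ns ! 0 \<le> ns ! 1} <+>
     (SIGMA c:third_entries N. {..<(N - c - 2) div 6})"

text \<open>\<open>Inl\<close> is antisymmetry, once per pair of swapped indices; for equal first
  two entries it reads \<open>2 * f ns = 0\<close>. \<open>Inr\<close> is the vanishing of one odd
  coefficient of a slice.\<close>

fun period_eq_coeff :: "nat list + (nat \<times> nat) \<Rightarrow> nat list \<Rightarrow> rat" where
  "period_eq_coeff (Inl ms) ns =
     (if ns = ms then 1 else 0) + (if ns = [ms ! 1, ms ! 0, ms ! 2] then 1 else 0)"
| "period_eq_coeff (Inr (c, j)) ns =
     (if ns ! 2 = c then Polynomial.coeff (three_term (ns ! 0 - 1) (ns ! 1 - 1)) (2 * j + 1) else 0)"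

lemma period_eqs_imp_period3:
  assumes eqs: "\<And>e. e \<in> period_eqs N \<Longrightarrow> (\<Sum>ns\<in>Sset N 3. period_eq_coeff e ns * f ns) = 0"
  shows "period3 N f"
proof (rule period3I)
  have le: "f [ms ! 1, ms ! 0, ms ! 2] = - f ms" if ms: "ms \<in> Sset N 3" "ms ! 0 \<le> ms ! 1" for ms
  proof -
    have swap: "[ms ! 1, ms ! 0, ms ! 2] \<in> Sset N 3" using ms(1) by (auto elim!: Sset3_E)
    have "Inl ms \<in> period_eqs N" using ms by (auto simp: period_eqs_def)
    then have "0 = (\<Sum>ns\<in>Sset N 3. period_eq_coeff (Inl ms) ns * f ns)"
      by (rule eqs[symmetric])
    also have "\<dots> = (\<Sum>ns\<in>Sset N 3. if ns = ms then f ns else 0)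
        + (\<Sum>ns\<in>Sset N 3. if ns = [ms ! 1, ms ! 0, ms ! 2] then f ns else 0)"
      unfolding sum.distrib[symmetric] by (intro sum.cong refl) auto
    also have "\<dots> = f ms + f [ms ! 1, ms ! 0, ms ! 2]"
      using ms(1) swap by (simp del: Sset3_iff)
    finally show ?thesis by simp
  qed
  fix ns assume ns: "ns \<in> Sset N 3"
  show "f [ns ! 1, ns ! 0, ns ! 2] = - f ns"
  proof (cases "ns ! 0 \<le> ns ! 1")
    case False
    have "[ns ! 1, ns ! 0, ns ! 2] \<in> Sset N 3" using ns by (auto elim!: Sset3_E)
    then show ?thesis using le[of "[ns ! 1, ns ! 0, ns ! 2]"] False ns by (auto elim!: Sset3_E)
  qed (use le ns in simp)
next
  fix c j assume c: "c \<in> third_entries N" "j < (N - c - 2) div 6"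
  have "Inr (c, j) \<in> period_eqs N" using c by (auto simp: period_eqs_def)
  then have "0 = (\<Sum>ns\<in>Sset N 3. period_eq_coeff (Inr (c, j)) ns * f ns)"
    by (rule eqs[symmetric])
  also have "\<dots> = (\<Sum>ns\<in>{ns \<in> Sset N 3. ns ! 2 = c}.
      f ns * Polynomial.coeff (three_term (ns ! 0 - 1) (ns ! 1 - 1)) (2 * j + 1))"
    by (intro sum.mono_neutral_cong_right) auto
  also have "\<dots> = Polynomial.coeff (slice N f c) (2 * j + 1)"
    by (simp add: slice_def Polynomial.coeff_sum)
  finally show "Polynomial.coeff (slice N f c) (2 * j + 1) = 0" by simp
qed

lemma finite_third_entries [simp]: "finite (third_entries N)"
  by (rule finite_subset[of _ "{..N}"]) (auto simp: third_entries_def)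

lemma finite_period_eqs [simp]: "finite (period_eqs N)"
  by (simp add: period_eqs_def)

text \<open>For fixed \<open>c\<close> the second entry is \<open>2 * t + 3\<close>, and it is
  smaller than the first exactly when \<open>t\<close> is below the bound.\<close>

lemma card_Sset3_gt:
  "card {ns \<in> Sset N 3. ns ! 1 < ns ! 0} = (\<Sum>c\<in>third_entries N. ((N - c) div 2 - 2) div 2)"
proof -
  have index: "(b - 3) div 2 < ((a + b) div 2 - 2) div 2"
    if "odd a" "odd b" "b < a" "3 \<le> b" for a b :: nat
  proof -
    obtain p q where ab: "a = 2 * p + 1" "b = 2 * q + 1" using \<open>odd a\<close> \<open>odd b\<close> by (elim oddE)
    then have "2 * q \<le> p + q + 1 - 2" "1 \<le> q" using that by auto
    moreover have "(a + b) div 2 = p + q + 1" "(b - 3) div 2 = q - 1" unfolding ab by auto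
    ultimately show ?thesis using div_le_mono[of "2 * q" "p + q + 1 - 2" 2] by simp linarith
  qed
  have "bij_betw (\<lambda>(c, t). [N - c - (2 * t + 3), 2 * t + 3, c])
      (SIGMA c:third_entries N. {..<((N - c) div 2 - 2) div 2}) {ns \<in> Sset N 3. ns ! 1 < ns ! 0}"
  proof (rule bij_betw_byWitness[where f' = "\<lambda>ns. (ns ! 2, (ns ! 1 - 3) div 2)"])
    show "\<forall>ns\<in>{ns \<in> Sset N 3. ns ! 1 < ns ! 0}.
        (case (ns ! 2, (ns ! 1 - 3) div 2) of (c, t) \<Rightarrow> [N - c - (2 * t + 3), 2 * t + 3, c]) = ns"
      by (auto elim!: Sset3_E)
    show "(\<lambda>(c, t). [N - c - (2 * t + 3), 2 * t + 3, c]) ` (SIGMA c:third_entries N. {..<((N - c) div 2 - 2) div 2})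
        \<subseteq> {ns \<in> Sset N 3. ns ! 1 < ns ! 0}"
      by (auto simp: third_entries_def)
    show "(\<lambda>ns. (ns ! 2, (ns ! 1 - 3) div 2)) ` {ns \<in> Sset N 3. ns ! 1 < ns ! 0}
        \<subseteq> (SIGMA c:third_entries N. {..<((N - c) div 2 - 2) div 2})"
      by (auto elim!: Sset3_E simp: third_entries_def index)
  qed auto
  from bij_betw_same_card[OF this] show ?thesis by simp
qed

text \<open>The antisymmetry equations match the indices with \<open>ns ! 0 \<le> ns ! 1\<close>.
  The other indices are compared with the slice equations through \<open>cusp_dim_eq\<close>, one
  \<open>c\<close> at a time.\<close>

lemma card_Sset3_eq:
  "card (Sset N 3) = card (period_eqs N) + (\<Sum>c\<in>third_entries N. cusp_dim (N - c))"
proof -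
  have "card (Sset N 3) = card {ns \<in> Sset N 3. ns ! 0 \<le> ns ! 1} + card {ns \<in> Sset N 3. ns ! 1 < ns ! 0}"
    by (subst card_Un_disjoint[symmetric]) (auto intro!: arg_cong[of _ _ card])
  moreover have "(\<Sum>c\<in>third_entries N. ((N - c) div 2 - 2) div 2)
      = (\<Sum>c\<in>third_entries N. cusp_dim (N - c)) + (\<Sum>c\<in>third_entries N. (N - c - 2) div 6)"
    unfolding sum.distrib[symmetric]
    by (intro sum.cong refl cusp_dim_eq[symmetric]) (auto simp: third_entries_def)
  ultimately show ?thesis
    using card_Sset3_gt[of N] by (simp add: period_eqs_def card_Plus)
qed

lemma fps_nth_OS: "fps_nth (2 * Ofps * Sfps) N = of_nat (2 * (\<Sum>c\<in>third_entries N. cusp_dim (N - c)))"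
proof -
  have "fps_nth (Ofps * Sfps) N = (\<Sum>c=0..N. if odd c \<and> 3 \<le> c then of_nat (cusp_dim (N - c)) else 0)"
    unfolding fps_mult_nth fps_nth_Ofps fps_nth_Sfps by (intro sum.cong) auto
  \<comment> \<open>The terms with \<open>N - c\<close> odd are dropped; there
    \<open>cusp_dim\<close> is 0.\<close>
  also have "\<dots> = (\<Sum>c\<in>third_entries N. of_nat (cusp_dim (N - c)))"
    by (intro sum.mono_neutral_cong_right) (auto simp: third_entries_def cusp_dim_def)
  finally have "fps_nth (Ofps * Sfps) N = of_nat (\<Sum>c\<in>third_entries N. cusp_dim (N - c))" by simp
  moreover have double: "2 * Ofps * Sfps = Ofps * Sfps + Ofps * Sfps" by simp
  ultimately show ?thesis unfolding double fps_add_nth by simp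
qed

section \<open>The dimension bound\<close>

lemma E_row_cong:
  "(\<And>ms. ms \<in> Sset N 3 \<Longrightarrow> f ms = g ms) \<Longrightarrow> E_row N f ns = E_row N g ns"
  unfolding E_row_def by (intro sum.cong) auto

lemma period3_zero: "period3 N (\<lambda>_. 0)"
  by (simp add: period3_def form3_def)

text \<open>Hypothesis (H) is applied to \<open>f\<close> and 0: their images under \<open>F\<close>
  agree, since \<open>F\<close> acts on period polynomials as minus \<open>E2\<close>.\<close>

lemma E2_row_0_imp_0:
  assumes hypH "period3 N f" "\<And>ns. ns \<in> Sset N 3 \<Longrightarrow> E2_row N f ns = 0" "ns \<in> Sset N 3"
  shows "f ns = 0"
proof -
  have F: "transpose_mat (Fmat N 3) *\<^sub>v vec3 N g = vec3 N (\<lambda>ns. - E2_row N g ns)"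
    if "period3 N g" for g
    unfolding transpose_Fmat_mult by (rule vec3_cong) (rule period3_F_row[OF that])
  have "inj_on (\<lambda>v. transpose_mat (Fmat N 3) *\<^sub>v v) (Wvec N 3)"
    using assms(1) by (simp add: hypH_def)
  moreover have "transpose_mat (Fmat N 3) *\<^sub>v vec3 N f = transpose_mat (Fmat N 3) *\<^sub>v vec3 N (\<lambda>_. 0)"
    unfolding F[OF assms(2)] F[OF period3_zero]
    by (rule vec3_cong) (simp add: assms(3), simp add: E2_row_def)
  ultimately have "vec3 N f = vec3 N (\<lambda>_. 0)"
    using period3_in_Wvec[OF assms(2)] period3_in_Wvec[OF period3_zero] by (auto dest: inj_onD)
  also have "\<dots> = 0\<^sub>v (sdim N 3)" by (auto simp: vec3_def)
  finally show ?thesis using assms(4) by (rule vec3_eq_0D)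
qed

text \<open>For period polynomials \<open>f\<close> and \<open>g\<close>, \<open>f + rot g\<close>
  lies in the left kernel of \<open>C\<close>. Requiring its \<open>kernel_dim\<close> coordinates
  to vanish leaves only \<open>f = g = 0\<close>, so the system cannot have fewer equations than its
  \<open>2 * card (Sset N 3)\<close> unknowns.\<close>

lemma kernel_dim_Cmat_ge:
  assumes hypH
  shows "2 * card (Sset N 3) \<le> 2 * card (period_eqs N) + kernel_dim (Cmat N 3)"
proof (rule ccontr)
  assume less: "\<not> ?thesis"
  let ?S = "Sset N 3" and ?E = "period_eqs N" and ?n = "sdim N 3"
  define rot where "rot g ns = g [ns ! 1, ns ! 2, ns ! 0]" for g :: "nat list \<Rightarrow> rat" and ns
  have C: "Cmat N 3 \<in> carrier_mat ?n ?n"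
    unfolding Cmat_3 by (rule mult_carrier_mat[OF Ej_carrier Emat_carrier])
  obtain J :: "nat set" and D where J: "finite J" "card J = kernel_dim (Cmat N 3)"
    and D: "\<forall>v\<in>carrier_vec ?n. transpose_mat (Cmat N 3) *\<^sub>v v = 0\<^sub>v ?n \<longrightarrow>
      (\<forall>j\<in>J. (\<Sum>i<?n. D j i * v $ i) = 0) \<longrightarrow> v = 0\<^sub>v ?n"
    by (rule left_kernel_coordinates[OF C])
  define pos where "pos = the_inv_into {..<?n} (\<lambda>p. Slist N 3 ! p)"
  have inj: "inj_on (\<lambda>p. Slist N 3 ! p) {..<?n}"
    using distinct_Slist[of N 3] by (auto simp: inj_on_def sdim_def nth_eq_iff_index_eq)
  have D_sum: "(\<Sum>i<?n. D j i * vec3 N f $ i) = (\<Sum>ns\<in>?S. D j (pos ns) * f ns)" for j f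
  proof -
    have "(\<Sum>i<?n. D j i * vec3 N f $ i) = (\<Sum>i<?n. D j (pos (Slist N 3 ! i)) * f (Slist N 3 ! i))"
      by (intro sum.cong refl) (simp add: pos_def the_inv_into_f_f[OF inj] vec3_def)
    also have "\<dots> = (\<Sum>ns\<in>?S. D j (pos ns) * f ns)"
      by (rule sum_Slist[where h = "\<lambda>ns. D j (pos ns) * f ns"])
    finally show ?thesis .
  qed
  \<comment> \<open>Moves the rotation from \<open>g\<close> to the coefficients, making each kernel
    coordinate of \<open>f + rot g\<close> a linear form in the values of \<open>f\<close> and
    \<open>g\<close>.\<close>
  have rot_sum: "(\<Sum>ns\<in>?S. h ns * rot g ns) = (\<Sum>ns\<in>?S. h [ns ! 2, ns ! 0, ns ! 1] * g ns)" for h g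
    unfolding rot_def
    by (rule sum.reindex_bij_witness[of _ "\<lambda>ns. [ns ! 2, ns ! 0, ns ! 1]" "\<lambda>ns. [ns ! 1, ns ! 2, ns ! 0]"])
      (auto elim!: Sset3_E)
  \<comment> \<open>The first two groups of equations make \<open>f\<close> and \<open>g\<close>
    period polynomials, the third kills the kernel coordinates of \<open>f + rot g\<close>.\<close>
  define c where "c e x = (case e of
      Inl e \<Rightarrow> (case x of Inl ns \<Rightarrow> period_eq_coeff e ns | Inr ns \<Rightarrow> 0)
    | Inr (Inl e) \<Rightarrow> (case x of Inl ns \<Rightarrow> 0 | Inr ns \<Rightarrow> period_eq_coeff e ns)
    | Inr (Inr j) \<Rightarrow> (case x of Inl ns \<Rightarrow> D j (pos ns) | Inr ns \<Rightarrow> D j (pos [ns ! 2, ns ! 0, ns ! 1])))"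
    for e :: "(nat list + (nat \<times> nat)) + (nat list + (nat \<times> nat)) + nat" and x
  have "card (?E <+> ?E <+> J) < card (?S <+> ?S)"
    using less J by (simp add: card_Plus)
  moreover have "finite (?E <+> ?E <+> J)" "finite (?S <+> ?S)" using J by simp_all
  ultimately obtain x where x: "\<exists>i\<in>?S <+> ?S. x i \<noteq> 0"
    and sol: "\<And>e. e \<in> ?E <+> ?E <+> J \<Longrightarrow> (\<Sum>i\<in>?S <+> ?S. c e i * x i) = 0"
    using homogeneous_system_nontrivial_solution[of "?E <+> ?E <+> J" "?S <+> ?S" c] by blast
  define f g where "f ns = x (Inl ns)" and "g ns = x (Inr ns)" for ns
  have split: "(\<Sum>i\<in>?S <+> ?S. c e i * x i)
      = (\<Sum>ns\<in>?S. c e (Inl ns) * f ns) + (\<Sum>ns\<in>?S. c e (Inr ns) * g ns)" for e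
    by (simp add: sum.Plus f_def g_def)
  have f: "period3 N f"
  proof (rule period_eqs_imp_period3)
    fix e assume "e \<in> ?E"
    then have "Inl e \<in> ?E <+> ?E <+> J" by auto
    from sol[OF this] show "(\<Sum>ns\<in>?S. period_eq_coeff e ns * f ns) = 0"
      unfolding split by (simp add: c_def)
  qed
  have g: "period3 N g"
  proof (rule period_eqs_imp_period3)
    fix e assume "e \<in> ?E"
    then have "Inr (Inl e) \<in> ?E <+> ?E <+> J" by auto
    from sol[OF this] show "(\<Sum>ns\<in>?S. period_eq_coeff e ns * g ns) = 0"
      unfolding split by (simp add: c_def)
  qed
  have rot_g: "E2_row N (rot g) ns = 0" if "ns \<in> ?S" for ns
    using period3_E2_row_rotate[OF g that] by (simp add: rot_def[abs_def])
  define v where "v = vec3 N (\<lambda>ns. f ns + rot g ns)"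
  \<comment> \<open>\<open>E2\<close> kills the rotated summand, so only \<open>f\<close>
    contributes when \<open>E\<close> is applied.\<close>
  have "E_row N (E2_row N (\<lambda>ns. f ns + rot g ns)) ns = 0" if ns: "ns \<in> ?S" for ns
  proof -
    have "E_row N (E2_row N (\<lambda>ns. f ns + rot g ns)) ns = E_row N (E2_row N f) ns"
    proof (rule E_row_cong)
      fix ms assume "ms \<in> ?S"
      have "E2_row N (\<lambda>ns. f ns + rot g ns) ms = E2_row N f ms + E2_row N (rot g) ms"
        by (simp only: E2_row_def distrib_right sum.distrib)
      then show "E2_row N (\<lambda>ns. f ns + rot g ns) ms = E2_row N f ms"
        using rot_g[OF \<open>ms \<in> ?S\<close>] by simp
    qed
    then show ?thesis using period3_E_E2_row[OF f ns] by simp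
  qed
  then have "vec3 N (E_row N (E2_row N (\<lambda>ns. f ns + rot g ns))) = vec3 N (\<lambda>_. 0)"
    by (rule vec3_cong)
  then have "transpose_mat (Cmat N 3) *\<^sub>v v = 0\<^sub>v ?n"
    unfolding v_def transpose_Cmat_mult by (auto simp: vec3_def)
  moreover have "(\<Sum>i<?n. D j i * v $ i) = 0" if "j \<in> J" for j
  proof -
    have "Inr (Inr j) \<in> ?E <+> ?E <+> J" using that by auto
    from sol[OF this] show ?thesis
      unfolding split v_def D_sum distrib_left sum.distrib rot_sum[of "\<lambda>ns. D j (pos ns)"]
      by (simp add: c_def)
  qed
  ultimately have "v = 0\<^sub>v ?n" using D by (simp add: v_def)
  then have sum0: "f ns + rot g ns = 0" if "ns \<in> ?S" for ns
    unfolding v_def using that by (rule vec3_eq_0D)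
  \<comment> \<open>Applying \<open>E2\<close> to the vanishing sum isolates \<open>f\<close>; (H)
    then gives \<open>f = 0\<close>, and hence \<open>g = 0\<close>.\<close>
  have "E2_row N f ns = 0" if ns: "ns \<in> ?S" for ns
  proof -
    have "E2_row N f ns + E2_row N (rot g) ns = (\<Sum>ms\<in>?S. (f ms + rot g ms) *
        ((if take 1 ms = take 1 ns then 1 else 0) * ecoef (drop 1 ms) (drop 1 ns)))"
      by (simp only: E2_row_def distrib_right sum.distrib)
    also have "\<dots> = 0" by (rule sum.neutral) (simp add: sum0)
    finally show ?thesis using rot_g[OF ns] by simp
  qed
  then have f0: "f ns = 0" if "ns \<in> ?S" for ns
    using E2_row_0_imp_0[OF assms f _ that] by blast
  have g0: "g ns = 0" if "ns \<in> ?S" for ns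
  proof -
    have "[ns ! 2, ns ! 0, ns ! 1] \<in> ?S" "rot g [ns ! 2, ns ! 0, ns ! 1] = g ns"
      using that by (auto elim!: Sset3_E simp: rot_def)
    then show ?thesis using f0 sum0 by fastforce
  qed
  show False using x f0 g0 by (auto simp: f_def g_def)
qed

theorem theorem1p1:
  assumes "hypH"
  shows "\<forall>N::nat. 0 < N \<longrightarrow>
           fps_nth (2 * Ofps * Sfps) N \<le> of_nat (kernel_dim (Cmat N 3))"
proof (intro allI impI)
  fix N :: nat
  have "2 * (\<Sum>c\<in>third_entries N. cusp_dim (N - c)) \<le> kernel_dim (Cmat N 3)"
    using kernel_dim_Cmat_ge[OF assms, of N] card_Sset3_eq[of N] by simp
  then show "fps_nth (2 * Ofps * Sfps) N \<le> of_nat (kernel_dim (Cmat N 3))"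
    unfolding fps_nth_OS by (rule of_nat_mono)
qed

end
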